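(* Let $G$ be a connected graph on $n\ge 3$ vertices, and let $k\ge 0$ and $r\in\{0,1,2,3\}$ be integers with $\kappa(G)=4k+r$. Then $\kappa_3(G)\geq 3k+\lceil r/2\rceil$. Moreover, this lower bound is sharp: for all integers $k\ge 0$ and $r\in\{0,1,2,3\}$ with $4k+r\ge 1$ there exists a connected graph $G$ with $\kappa(G)=4k+r$ and $\kappa_3(G)=3k+\lceil r/2\rceil$.
   Context: All graphs are finite and simple. $\kappa(G)$ denotes the (vertex) connectivity of $G$: the minimum cardinality of a vertex set $Q$ such that $G-Q$ is disconnected or trivial. For a set $S$ of vertices of a connected graph $G$, a tree connecting $S$ is a subtree of $G$ containing all vertices of $S$; $\kappa(S)$ denotes the maximum number $\ell$ of edge-disjoint trees $T_1,\ldots,T_\ell$ in $G$, each connecting $S$, such that $V(T_i)\cap V(T_j)=S$ for all distinct $i,j$. The $3$-connectivity is $\kappa_3(G)=\min\{\kappa(S): S\subseteq V(G),\ |S|=3\}$. *)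

theory Defs
  imports Complex_Main "Graph_Theory.Graph_Theory"
begin

text \<open>
  A finite simple graph is a \<^locale>\<open>pair_graph\<close>: a finite, loop-free, symmetric set of arcs,
  in which an undirected edge is a pair of opposite arcs. The name \<open>connected\<close> is qualified
  throughout because of the topological constant of the same name.
\<close>

text \<open>
  The null graph is not connected in the sense of \<^const>\<open>Digraph_Component.connected\<close>, so the
  whole vertex set is also admitted as \<open>Q\<close>. This does not affect the minimum, because deleting
  all vertices but one already leaves a trivial graph.
\<close>

definition connectivity :: "'a pair_pre_digraph \<Rightarrow> nat" where
  "connectivity G = Min {card Q | Q. Q \<subseteq> pverts G \<and>
     (\<not> Digraph_Component.connected (with_proj G \<restriction> (pverts G - Q)) \<or> card (pverts G - Q) = 1)}"

text \<open>
  The constant \<^const>\<open>Digraph_Component.tree\<close> does not describe undirected trees: its acyclicity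
  condition refers to directed cycles, and a pair of opposite arcs forms a directed cycle of
  length two. In a symmetric loop-free digraph, the undirected cycles are the directed cycles of
  length at least three.
\<close>

definition undirected_tree :: "'a pair_pre_digraph \<Rightarrow> bool" where
  "undirected_tree T \<longleftrightarrow> pair_graph T \<and> Digraph_Component.connected (with_proj T) \<and>
     \<not> (\<exists>p. pre_digraph.cycle (with_proj T) p \<and> length p \<ge> 3)"

definition tree_connecting :: "'a pair_pre_digraph \<Rightarrow> 'a set \<Rightarrow> 'a pair_pre_digraph \<Rightarrow> bool" where
  "tree_connecting G S T \<longleftrightarrow>
     undirected_tree T \<and> subgraph (with_proj T) (with_proj G) \<and> S \<subseteq> pverts T"

text \<open>
  The set below is finite if \<open>G\<close> is finite and \<open>S\<close> has at least two elements, since then each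
  tree has an arc and the arc sets are disjoint.
\<close>

definition set_connectivity :: "'a pair_pre_digraph \<Rightarrow> 'a set \<Rightarrow> nat" where
  "set_connectivity G S = Max {l. \<exists>T :: nat \<Rightarrow> 'a pair_pre_digraph.
     (\<forall>i<l. tree_connecting G S (T i)) \<and>
     (\<forall>i<l. \<forall>j<l. i \<noteq> j \<longrightarrow>
        parcs (T i) \<inter> parcs (T j) = {} \<and> pverts (T i) \<inter> pverts (T j) = S)}"

definition connectivity3 :: "'a pair_pre_digraph \<Rightarrow> nat" where
  "connectivity3 G = Min {set_connectivity G S | S. S \<subseteq> pverts G \<and> card S = 3}"

end

theory Submission
  imports Defs
begin

text \<open>
  Let \<open>m\<close> be the connectivity of \<open>G\<close> and \<open>S = {v1, v2, v3}\<close>. Menger's theorem gives \<open>m\<close> internally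
  disjoint \<open>v1\<close>-\<open>v2\<close> paths and \<open>m\<close> internally disjoint \<open>v3\<close>-\<open>v1\<close> paths. Stop each of the latter as late as
  possible, subject to the rule that it may run through a vertex of a \<open>v1\<close>-\<open>v2\<close> path only if that vertex
  lies strictly between two vertices of this path at which walks starting in \<open>v3\<close> have stopped.
  Every walk then ends in a terminal or as the first or last stop on some \<open>v1\<close>-\<open>v2\<close> path. A \<open>v1\<close>-\<open>v2\<close> path
  without a stop is kept, one with a single stop becomes a claw, and one with several stops splits
  into a \<open>v1\<close>-\<open>v3\<close> path and a \<open>v2\<close>-\<open>v3\<close> path. If \<open>c\<close> is the number of claws, any two of the three kinds of
  paths together have at least \<open>m - c\<close> members, so that pairing paths of different kinds
  yields at least \<open>(3 (m - c) + 1) div 4\<close> further trees. Finally \<open>(3 m + 1) div 4 = 3 k + \<lceil>r / 2\<rceil>\<close> if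
  \<open>m = 4 k + r\<close>.
\<close>

section \<open>Menger's theorem\<close>

text \<open>The stopping rule is made for disjointness: before its stop, a walk meets a
  \<open>v1\<close>-\<open>v2\<close> path only strictly between two stops, whereas only the
  portions before the first and after the last stop are kept. Such meetings stay permitted, because
  only stops that are not outermost on a path ever advance. Of the three lower bounds
  \<open>m - c\<close>, the two that involve \<open>v1\<close>-\<open>v2\<close> paths come from
  counting these paths, the third from counting the walks from \<open>v3\<close>. The obstacle is
  degenerate blocks. A block may be a single arc between terminals, about which disjointness of
  inner vertices says nothing, and the same arc may arise both from a path through \<open>v3\<close>
  and from a walk. The counts are therefore made per kind, for paths and for walks separately. The
  factor 3/4: three kinds whose pairwise sums are at least \<open>n\<close> have at least
  \<open>3 n / 2\<close> members, and a tree uses two of them. In the extremal graph this recurs as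
  a count of vertices: each terminal sees \<open>2 t\<close> of only \<open>3 t\<close> clique
  vertices, and a tree needs two of these.\<close>

definition walk_in :: "('a \<times> 'a) set \<Rightarrow> 'a list \<Rightarrow> bool" where
  "walk_in E xs \<longleftrightarrow> xs \<noteq> [] \<and> successively (\<lambda>x y. (x, y) \<in> E) xs"

lemma walk_in_mono: "walk_in E xs \<Longrightarrow> E \<subseteq> F \<Longrightarrow> walk_in F xs"
  unfolding walk_in_def by (auto intro: successively_mono)

lemma walk_in_append:
  assumes "xs \<noteq> []" "ys \<noteq> []"
  shows "walk_in E (xs @ ys) \<longleftrightarrow> walk_in E xs \<and> walk_in E ys \<and> (last xs, hd ys) \<in> E"
  using assms by (auto simp: walk_in_def successively_append_iff)

lemma walk_in_join:
  "walk_in E (xs @ z # ys) \<longleftrightarrow> walk_in E (xs @ [z]) \<and> walk_in E (z # ys)"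
  by (cases ys) (auto simp: walk_in_def successively_append_iff)

lemma walk_in_rev: "sym E \<Longrightarrow> walk_in E (rev xs) \<longleftrightarrow> walk_in E xs"
  by (auto simp: walk_in_def successively_rev elim: successively_mono dest: symD)

lemma walk_in_distinct:
  assumes "walk_in E xs"
  shows "\<exists>ys. walk_in E ys \<and> distinct ys \<and> hd ys = hd xs \<and> last ys = last xs \<and> set ys \<subseteq> set xs"
  using assms
proof (induction "length xs" arbitrary: xs rule: less_induct)
  case less
  show ?case
  proof (cases "distinct xs")
    case False
    then obtain a y b c where xs: "xs = a @ [y] @ b @ [y] @ c"
      using not_distinct_decomp by blast
    let ?zs = "a @ y # c"
    have "walk_in E ?zs"
      using less.prems unfolding xs by (metis append_Cons append_Nil append_assoc walk_in_join)
    moreover have "length ?zs < length xs" "hd ?zs = hd xs" "last ?zs = last xs" "set ?zs \<subseteq> set xs"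
      unfolding xs by (auto simp: hd_append)
    ultimately show ?thesis using less.hyps[of ?zs] by (metis subset_trans)
  qed (use less.prems in blast)
qed

text \<open>A walk uses the arc \<open>(x, y)\<close> only by leaving \<open>x\<close>, hence only
  if \<open>x\<close> occurs before its last position.\<close>

lemma walk_in_insert_tail:
  assumes "walk_in (insert (x, y) F) xs" "x \<notin> set (butlast xs)"
  shows "walk_in F xs"
  using assms
proof (induction xs)
  case (Cons a xs)
  then show ?case by (cases xs) (auto simp: walk_in_def successively_Cons)
qed (simp add: walk_in_def)

lemma walk_in_insert_head:
  assumes "walk_in (insert (x, y) F) xs" "y \<notin> set (tl xs)"
  shows "walk_in F xs"
  using assms
proof (induction xs)
  case (Cons a xs)
  then show ?case by (cases xs) (auto simp: walk_in_def successively_Cons)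
qed (simp add: walk_in_def)

text \<open>One-vertex walks count: a separator contains \<open>A \<inter> B\<close>, and
  correspondingly a \<open>linkage\<close> may contain one-vertex paths.\<close>

definition separates :: "('a \<times> 'a) set \<Rightarrow> 'a set \<Rightarrow> 'a set \<Rightarrow> 'a set \<Rightarrow> bool" where
  "separates E A B X \<longleftrightarrow>
     (\<forall>xs. walk_in E xs \<longrightarrow> hd xs \<in> A \<longrightarrow> last xs \<in> B \<longrightarrow> set xs \<inter> X \<noteq> {})"

definition linkage :: "('a \<times> 'a) set \<Rightarrow> 'a set \<Rightarrow> 'a set \<Rightarrow> nat \<Rightarrow> (nat \<Rightarrow> 'a list) \<Rightarrow> bool" where
  "linkage E A B k p \<longleftrightarrow>
     (\<forall>i<k. walk_in E (p i) \<and> distinct (p i) \<and> hd (p i) \<in> A \<and> last (p i) \<in> B) \<and>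
     (\<forall>i<k. \<forall>j<k. i \<noteq> j \<longrightarrow> set (p i) \<inter> set (p j) = {})"

lemma linkage_disjoint:
  "linkage E A B k p \<Longrightarrow> i < k \<Longrightarrow> j < k \<Longrightarrow> x \<in> set (p i) \<Longrightarrow> x \<in> set (p j) \<Longrightarrow> i = j"
  unfolding linkage_def by blast

text \<open>Pigeonhole: the \<open>k\<close> disjoint paths have \<open>k\<close> different last
  vertices, all in the \<open>k\<close>-element set \<open>B\<close>.\<close>

lemma linkage_onto:
  assumes "linkage E A B k p" "finite B" "card B = k" "v \<in> B"
  shows "\<exists>i<k. last (p i) = v"
proof -
  have ne: "p i \<noteq> []" if "i < k" for i using that assms(1) by (auto simp: linkage_def walk_in_def)
  have "inj_on (\<lambda>i. last (p i)) {..<k}"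
    using linkage_disjoint[OF assms(1)] ne by (intro inj_onI) (metis last_in_set lessThan_iff)
  then have "card ((\<lambda>i. last (p i)) ` {..<k}) = card B" using assms(3) by (simp add: card_image)
  moreover have "(\<lambda>i. last (p i)) ` {..<k} \<subseteq> B" using assms(1) by (auto simp: linkage_def)
  ultimately have "(\<lambda>i. last (p i)) ` {..<k} = B" using assms(2) by (simp add: card_subset_eq)
  then show ?thesis using assms(4) by auto
qed

lemma linkage_onto_hd:
  assumes "linkage E A B k p" "finite A" "card A = k" "v \<in> A"
  shows "\<exists>i<k. hd (p i) = v"
proof -
  have ne: "p i \<noteq> []" if "i < k" for i using that assms(1) by (auto simp: linkage_def walk_in_def)
  have "inj_on (\<lambda>i. hd (p i)) {..<k}"
    using linkage_disjoint[OF assms(1)] ne by (intro inj_onI) (metis hd_in_set lessThan_iff)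
  then have "card ((\<lambda>i. hd (p i)) ` {..<k}) = card A" using assms(3) by (simp add: card_image)
  moreover have "(\<lambda>i. hd (p i)) ` {..<k} \<subseteq> A" using assms(1) by (auto simp: linkage_def)
  ultimately have "(\<lambda>i. hd (p i)) ` {..<k} = A" using assms(2) by (simp add: card_subset_eq)
  then show ?thesis using assms(4) by auto
qed

text \<open>By \<open>linkage_onto\<close> the vertex \<open>v\<close> ends some path, and
  disjointness leaves only the path through it.\<close>

lemma linkage_last:
  assumes "linkage E A B k p" "finite B" "card B = k" "i < k" "v \<in> set (p i)" "v \<in> B"
  shows "v = last (p i)"
proof -
  obtain j where "j < k" "last (p j) = v" using linkage_onto[OF assms(1-3,6)] by blast
  moreover from this have "v \<in> set (p j)" using assms(1) by (auto simp: linkage_def walk_in_def)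
  ultimately show ?thesis using linkage_disjoint[OF assms(1,4) _ assms(5)] by blast
qed

lemma linkage_hd:
  assumes "linkage E A B k p" "finite A" "card A = k" "i < k" "v \<in> set (p i)" "v \<in> A"
  shows "v = hd (p i)"
proof -
  obtain j where "j < k" "hd (p j) = v" using linkage_onto_hd[OF assms(1-3,6)] by blast
  moreover from this have "v \<in> set (p j)" using assms(1) by (auto simp: linkage_def walk_in_def)
  ultimately show ?thesis using linkage_disjoint[OF assms(1,4) _ assms(5)] by blast
qed

text \<open>
  The induction step of Goering's proof: \<open>S\<close> separates \<open>A\<close> from \<open>B\<close> after the deletion of the arc \<open>(x, y)\<close>,
  and the linkages into \<open>S \<union> {x}\<close> and out of \<open>S \<union> {y}\<close> can meet only in \<open>S\<close>.
\<close>

lemma linkage_glue: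
  assumes fin: "finite S" and card: "card S + 1 = k" and xy: "x \<notin> S" "y \<notin> S"
    and sep: "separates F A B S"
    and p: "linkage F A (insert x S) k p" and q: "linkage F (insert y S) B k q"
  shows "\<exists>r. linkage (insert (x, y) F) A B k r"
proof -
  have cX: "finite (insert x S)" "card (insert x S) = k"
    and cY: "finite (insert y S)" "card (insert y S) = k"
    using fin card xy by auto
  have pw: "walk_in F (p i)" "distinct (p i)" "hd (p i) \<in> A" "last (p i) \<in> insert x S" "p i \<noteq> []"
    if "i < k" for i using that p by (auto simp: linkage_def walk_in_def)
  have qw: "walk_in F (q i)" "distinct (q i)" "hd (q i) \<in> insert y S" "last (q i) \<in> B" "q i \<noteq> []"
    if "i < k" for i using that q by (auto simp: linkage_def walk_in_def)
  \<comment> \<open>Following \<open>p i\<close> up to \<open>z\<close> and then \<open>q j\<close>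
    gives a walk of \<open>F\<close> from \<open>A\<close> to \<open>B\<close>, which must meet
    \<open>S\<close>. As \<open>p i\<close> meets \<open>S\<close> only at its end and
    \<open>q j\<close> only at its start, this happens in \<open>z\<close>.\<close>
  have meet: "z = last (p i) \<and> z = hd (q j) \<and> z \<in> S"
    if ij: "i < k" "j < k" and z: "z \<in> set (p i)" "z \<in> set (q j)" for i j z
  proof -
    obtain a b where a: "p i = a @ z # b" using z(1) split_list by metis
    obtain c d where d: "q j = c @ z # d" using z(2) split_list by metis
    have "walk_in F (a @ [z])" using pw(1)[OF ij(1)] unfolding a by (subst (asm) walk_in_join) simp
    moreover have "walk_in F (z # d)" using qw(1)[OF ij(2)] unfolding d by (subst (asm) walk_in_join) simp
    ultimately have "walk_in F (a @ z # d)" by (subst walk_in_join) simp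
    moreover have "hd (a @ z # d) \<in> A" using pw(3)[OF ij(1)] unfolding a by (cases a) auto
    moreover have "last (a @ z # d) \<in> B" using qw(4)[OF ij(2)] unfolding d by (cases d) auto
    ultimately have "set (a @ z # d) \<inter> S \<noteq> {}" using sep unfolding separates_def by blast
    then obtain s where s: "s \<in> S" "s \<in> set a \<union> {z} \<union> set d" by auto
    have "s = z"
    proof (rule ccontr)
      assume "s \<noteq> z"
      then consider "s \<in> set a" | "s \<in> set d" using s(2) by auto
      then show False
      proof cases
        case 1
        have "s = last (p i)" by (rule linkage_last[OF p cX ij(1)]) (use 1 s a in auto)
        moreover have "last (p i) \<in> set (z # b)" unfolding a by (metis last_appendR last_in_set list.distinct(1))
        ultimately show False using 1 pw(2)[OF ij(1)] unfolding a by auto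
      next
        case 2
        have "s = hd (q j)" by (rule linkage_hd[OF q cY ij(2)]) (use 2 s d in auto)
        moreover have "hd (q j) \<in> set (c @ [z])" unfolding d by (cases c) auto
        ultimately show False using 2 qw(2)[OF ij(2)] unfolding d by auto
      qed
    qed
    then have zS: "z \<in> S" using s by simp
    then show ?thesis using linkage_last[OF p cX ij(1) z(1)] linkage_hd[OF q cY ij(2) z(2)] by simp
  qed
  \<comment> \<open>A path ending in \<open>x\<close> continues across the new arc with the path
    starting in \<open>y\<close>; every other path continues at its own end.\<close>
  define g where "g v = (if v = x then y else v)" for v
  have "\<exists>j<k. hd (q j) = g (last (p i))" if "i < k" for i
    using linkage_onto_hd[OF q cY] pw(4)[OF that] by (auto simp: g_def)
  then obtain \<sigma> where \<sigma>: "\<sigma> i < k" "hd (q (\<sigma> i)) = g (last (p i))" if "i < k" for i by metis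
  have linj: "i = j" if "i < k" "j < k" "last (p i) = last (p j)" for i j
    using linkage_disjoint[OF p that(1,2)] pw(5) that by (metis last_in_set)
  have \<sigma>inj: "i = j" if ij: "i < k" "j < k" and "\<sigma> i = \<sigma> j" for i j
  proof -
    have "g (last (p i)) = g (last (p j))" using \<sigma> that by metis
    then have "last (p i) = last (p j)"
      using pw(4)[OF ij(1)] pw(4)[OF ij(2)] xy unfolding g_def by (auto split: if_splits)
    then show ?thesis using linj ij by blast
  qed
  define r where "r i = (if last (p i) = x then p i @ q (\<sigma> i) else p i @ tl (q (\<sigma> i)))" for i
  have r_sub: "set (r i) \<subseteq> set (p i) \<union> set (q (\<sigma> i))" if "i < k" for i
    using qw(5)[OF \<sigma>(1)[OF that]] by (auto simp: r_def dest: list.set_sel(2))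
  have cross: "i = j" if ij: "i < k" "j < k" and z: "z \<in> set (p i)" "z \<in> set (q (\<sigma> j))" for i j z
  proof -
    have m: "z = last (p i)" "z = hd (q (\<sigma> j))" "z \<in> S" using meet[OF ij(1) \<sigma>(1)[OF ij(2)] z] by auto
    then have "g (last (p j)) = z" using \<sigma>(2)[OF ij(2)] by simp
    then have "last (p j) = z" using m(3) xy by (auto simp: g_def split: if_splits)
    then show ?thesis using linj ij m by metis
  qed
  have "linkage (insert (x, y) F) A B k r"
    unfolding linkage_def
  proof (intro conjI allI impI)
    fix i assume i: "i < k"
    note \<sigma>i = \<sigma>[OF i] note P = pw[OF i] note Q = qw[OF \<sigma>i(1)]
    note PE = walk_in_mono[OF P(1), of "insert (x, y) F"] and QE = walk_in_mono[OF Q(1), of "insert (x, y) F"]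
    obtain b d where bd: "q (\<sigma> i) = b # d" using Q(5) by (cases "q (\<sigma> i)") auto
    show "walk_in (insert (x, y) F) (r i)"
    proof (cases "last (p i) = x")
      case True
      then have "hd (q (\<sigma> i)) = y" using \<sigma>i(2) by (simp add: g_def)
      then show ?thesis using True PE QE P(5) Q(5) by (auto simp: r_def walk_in_append)
    next
      case False
      then have b: "b = last (p i)" using \<sigma>i(2) bd by (simp add: g_def)
      have "walk_in (insert (x, y) F) (butlast (p i) @ b # d)"
        by (subst walk_in_join) (use PE QE P(5) bd b in auto)
      moreover have "butlast (p i) @ b # d = p i @ d" using b P(5) by simp
      ultimately show ?thesis using False bd by (simp add: r_def)
    qed
    show "distinct (r i)"
    proof -
      have "z \<notin> set (q (\<sigma> i))" if "last (p i) = x" "z \<in> set (p i)" for z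
        using meet[OF i \<sigma>i(1) that(2)] that(1) xy by auto
      moreover have "z \<notin> set d" if "z \<in> set (p i)" for z
        using meet[OF i \<sigma>i(1) that] bd Q(2) by auto
      ultimately show ?thesis using P(2) Q(2) bd by (auto simp: r_def)
    qed
    show "hd (r i) \<in> A" using P(3,5) by (simp add: r_def)
    show "last (r i) \<in> B"
    proof (cases "last (p i) = x")
      case True then show ?thesis using Q(4,5) by (simp add: r_def)
    next
      case False
      then have "b = last (p i)" using \<sigma>i(2) bd by (simp add: g_def)
      then show ?thesis using False Q(4) bd P(5) by (cases d) (auto simp: r_def)
    qed
  next
    fix i j assume ij: "i < k" "j < k" "i \<noteq> j"
    show "set (r i) \<inter> set (r j) = {}"
    proof (rule ccontr)
      assume "set (r i) \<inter> set (r j) \<noteq> {}"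
      then obtain z where "z \<in> set (p i) \<union> set (q (\<sigma> i))" "z \<in> set (p j) \<union> set (q (\<sigma> j))"
        using r_sub ij by blast
      then show False
        using cross ij linkage_disjoint[OF p] linkage_disjoint[OF q] \<sigma>(1) \<sigma>inj by (metis UnE)
    qed
  qed
  then show ?thesis by blast
qed

text \<open>Induction on the arcs, after Goering. If deleting \<open>(x, y)\<close> creates a
  separator \<open>S\<close> with fewer than \<open>k\<close> vertices, then
  \<open>insert x S\<close> and \<open>insert y S\<close> are minimum separators of the full arc
  set, and the induction hypothesis applies on either side of them.\<close>

theorem menger_sets:
  assumes "finite E" "finite A" "finite B"
    and "\<And>X. finite X \<Longrightarrow> separates E A B X \<Longrightarrow> k \<le> card X"
  shows "\<exists>p. linkage E A B k p"
  using assms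
proof (induction E arbitrary: A B k rule: finite_induct)
  case empty
  have single: "\<exists>a. xs = [a]" if "walk_in {} xs" for xs :: "'a list"
    using that by (cases xs rule: remdups_adj.cases) (auto simp: walk_in_def)
  have "separates {} A B (A \<inter> B)"
    unfolding separates_def
  proof (intro allI impI)
    fix xs assume "walk_in {} xs" "hd xs \<in> A" "last xs \<in> B"
    moreover from single[OF this(1)] obtain a where "xs = [a]" by blast
    ultimately show "set xs \<inter> (A \<inter> B) \<noteq> {}" by simp
  qed
  then have "k \<le> card (A \<inter> B)" using empty by simp
  then obtain C where C: "C \<subseteq> A \<inter> B" "card C = k" "finite C" by (rule obtain_subset_with_card_n)
  then obtain f where f: "bij_betw f {0..<k} C" using ex_bij_betw_nat_finite[of C] by auto
  have "linkage {} A B k (\<lambda>i. [f i])"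
    unfolding linkage_def
  proof (intro conjI allI impI)
    fix i assume "i < k"
    then have "f i \<in> C" using f by (auto simp: bij_betw_def)
    then show "hd [f i] \<in> A" "last [f i] \<in> B" using C(1) by auto
  qed (use f in \<open>auto simp: walk_in_def bij_betw_def inj_on_def\<close>)
  then show ?case by blast
next
  case (insert e F)
  obtain x y where e: "e = (x, y)" by (cases e)
  show ?case
  proof (cases "\<forall>X. finite X \<longrightarrow> separates F A B X \<longrightarrow> k \<le> card X")
    case True
    then have "\<exists>p. linkage F A B k p" by (intro insert.IH[OF insert.prems(1,2)]) simp
    then obtain p where "linkage F A B k p" by (elim exE)
    then have "linkage (insert e F) A B k p"
      unfolding linkage_def using walk_in_mono[of F _ "insert e F"] by blast
    then show ?thesis by blast
  next
    case False
    then have "\<exists>S. finite S \<and> separates F A B S \<and> card S < k" by (simp add: not_le)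
    then obtain S where S: "finite S" "separates F A B S" "card S < k" by (elim exE conjE)
    have sx: "separates (insert e F) A B (insert x S)"
      unfolding separates_def e
    proof (intro allI impI notI)
      fix xs assume w: "walk_in (insert (x, y) F) xs" "hd xs \<in> A" "last xs \<in> B"
        and d: "set xs \<inter> insert x S = {}"
      then have "walk_in F xs" by (intro walk_in_insert_tail[OF w(1)]) (auto dest: in_set_butlastD)
      then show False using S(2) w d unfolding separates_def by blast
    qed
    have sy: "separates (insert e F) A B (insert y S)"
      unfolding separates_def e
    proof (intro allI impI notI)
      fix xs assume w: "walk_in (insert (x, y) F) xs" "hd xs \<in> A" "last xs \<in> B"
        and d: "set xs \<inter> insert y S = {}"
      then have "walk_in F xs"
        by (intro walk_in_insert_head[OF w(1)]) (auto dest: list.set_sel(2)[rotated] simp: walk_in_def)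
      then show False using S(2) w d unfolding separates_def by blast
    qed
    \<comment> \<open>Both enlarged sets have at least \<open>k\<close> elements although
      \<open>S\<close> has fewer.\<close>
    have cs: "x \<notin> S" "y \<notin> S" "card S + 1 = k"
      using insert.prems(3)[OF _ sx] insert.prems(3)[OF _ sy] S by (auto simp: card_insert_if split: if_splits)
    have "\<exists>p. linkage F A (insert x S) k p"
    proof (rule insert.IH)
      fix Z assume Z: "finite Z" "separates F A (insert x S) Z"
      \<comment> \<open>The initial segment of a walk up to its first vertex in
        \<open>insert x S\<close> cannot use the arc \<open>(x, y)\<close>, so it lies in
        \<open>F\<close> and meets \<open>Z\<close>.\<close>
      have "separates (insert e F) A B Z"
        unfolding separates_def
      proof (intro allI impI)
        fix xs assume w: "walk_in (insert e F) xs" "hd xs \<in> A" "last xs \<in> B"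
        then have "\<exists>v\<in>set xs. v \<in> insert x S" using sx unfolding separates_def by blast
        then obtain a v b where a: "xs = a @ v # b" "v \<in> insert x S" "\<forall>u\<in>set a. u \<notin> insert x S"
          by (rule split_list_first_propE)
        have "walk_in (insert (x, y) F) (a @ [v])" using w(1) unfolding a(1) e by (subst (asm) walk_in_join) simp
        then have "walk_in F (a @ [v])" by (rule walk_in_insert_tail) (use a(3) in auto)
        moreover have "hd (a @ [v]) \<in> A" using w(2) a(1) by (cases a) auto
        moreover have "last (a @ [v]) \<in> insert x S" using a(2) by simp
        ultimately have "set (a @ [v]) \<inter> Z \<noteq> {}" using Z(2) unfolding separates_def by blast
        then show "set xs \<inter> Z \<noteq> {}" using a(1) by auto
      qed
      then show "k \<le> card Z" using insert.prems(3) Z by blast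
    qed (use insert.prems S in auto)
    moreover have "\<exists>q. linkage F (insert y S) B k q"
    proof (rule insert.IH)
      fix Z assume Z: "finite Z" "separates F (insert y S) B Z"
      have "separates (insert e F) A B Z"
        unfolding separates_def
      proof (intro allI impI)
        fix xs assume w: "walk_in (insert e F) xs" "hd xs \<in> A" "last xs \<in> B"
        then have "\<exists>v\<in>set xs. v \<in> insert y S" using sy unfolding separates_def by blast
        then obtain a v b where a: "xs = a @ v # b" "v \<in> insert y S" "\<forall>u\<in>set b. u \<notin> insert y S"
          by (rule split_list_last_propE)
        have "walk_in (insert (x, y) F) (v # b)" using w(1) unfolding a(1) e by (subst (asm) walk_in_join) simp
        then have "walk_in F (v # b)" by (rule walk_in_insert_head) (use a(3) in auto)
        moreover have "last (v # b) \<in> B" using w(3) a(1) by auto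
        moreover have "hd (v # b) \<in> insert y S" using a(2) by simp
        ultimately have "set (v # b) \<inter> Z \<noteq> {}" using Z(2) unfolding separates_def by blast
        then show "set xs \<inter> Z \<noteq> {}" using a(1) by auto
      qed
      then show "k \<le> card Z" using insert.prems(3) Z by blast
    qed (use insert.prems S in auto)
    ultimately show ?thesis using linkage_glue[OF S(1) cs(3,1,2) S(2)] e by blast
  qed
qed

section \<open>From linkages of sets to internally disjoint paths between two vertices\<close>

lemma rtrancl_walk:
  assumes "(a, b) \<in> R\<^sup>*"
  shows "\<exists>xs. walk_in R xs \<and> hd xs = a \<and> last xs = b"
  using assms
proof (induction rule: rtrancl_induct)
  case base
  then show ?case by (intro exI[of _ "[a]"]) (simp add: walk_in_def)
next
  case (step y z)
  then obtain xs where "walk_in R xs" "hd xs = a" "last xs = y" by blast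
  moreover from this have "xs \<noteq> []" by (simp add: walk_in_def)
  ultimately show ?case using step(2)
    by (intro exI[of _ "xs @ [z]"]) (auto simp: walk_in_append, auto simp: walk_in_def)
qed

lemma walk_subset:
  assumes "walk_in (E \<inter> U \<times> U) xs" "hd xs \<in> U"
  shows "set xs \<subseteq> U"
  using assms
proof (induction xs)
  case (Cons x xs)
  then show ?case by (cases xs) (auto simp: walk_in_def successively_Cons)
qed simp

lemma walk_restrict:
  assumes "walk_in E xs" "set xs \<subseteq> U"
  shows "walk_in (E \<inter> U \<times> U) xs"
  using assms
proof (induction xs)
  case (Cons x xs)
  then show ?case by (cases xs) (auto simp: walk_in_def successively_Cons)
qed (simp add: walk_in_def)

lemma rtrancl_path:
  assumes "(a, b) \<in> (E \<inter> U \<times> U)\<^sup>*" "a \<in> U"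
  shows "\<exists>xs. walk_in E xs \<and> distinct xs \<and> hd xs = a \<and> last xs = b \<and> set xs \<subseteq> U"
proof -
  obtain xs where "walk_in (E \<inter> U \<times> U) xs" "hd xs = a" "last xs = b"
    using rtrancl_walk[OF assms(1)] by blast
  from walk_in_distinct[OF this(1)] this(2,3) obtain ys where
    ys: "walk_in (E \<inter> U \<times> U) ys" "distinct ys" "hd ys = a" "last ys = b" by auto
  then have "set ys \<subseteq> U" using walk_subset assms(2) by metis
  then show ?thesis using ys walk_in_mono[OF ys(1), of E] by blast
qed

text \<open>The size condition replaces the alternative of a trivial remainder in
  \<open>connectivity\<close>; for a complete graph it alone limits \<open>k\<close>.\<close>

definition k_connected :: "'a set \<Rightarrow> ('a \<times> 'a) set \<Rightarrow> nat \<Rightarrow> bool" where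
  "k_connected V E k \<longleftrightarrow> k < card V \<and>
     (\<forall>Q\<subseteq>V. card Q < k \<longrightarrow> (\<forall>a\<in>V - Q. \<forall>b\<in>V - Q. (a, b) \<in> (E \<inter> (V - Q) \<times> (V - Q))\<^sup>*))"

lemma k_connected_path:
  assumes "k_connected V E k" "Q \<subseteq> V" "card Q < k" "a \<in> V - Q" "b \<in> V - Q"
  shows "\<exists>xs. walk_in E xs \<and> distinct xs \<and> hd xs = a \<and> last xs = b \<and> set xs \<subseteq> V - Q"
  using assms by (intro rtrancl_path) (auto simp: k_connected_def)

text \<open>If \<open>u\<close> and \<open>v\<close> are adjacent, the arc itself serves as one path
  and only \<open>k - 1\<close> others are needed. A smaller \<open>X\<close> may then be enlarged
  by \<open>u\<close> or by \<open>v\<close> without disconnecting the graph: a further vertex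
  \<open>w\<close> reaches \<open>v\<close> avoiding \<open>u\<close>, and \<open>u\<close> avoiding
  \<open>v\<close>, and the two walks compose to one that refutes separation.\<close>

lemma separator_card:
  assumes fin: "finite V" and sym: "sym E" and conn: "k_connected V E k"
    and uv: "u \<in> V" "v \<in> V" "u \<noteq> v"
    and X: "finite X" "separates (E \<inter> (V - {u, v}) \<times> (V - {u, v}))
      {x \<in> V - {u, v}. (u, x) \<in> E} {x \<in> V - {u, v}. (x, v) \<in> E} X"
  shows "(if (u, v) \<in> E then k - 1 else k) \<le> card X"
proof (rule ccontr)
  let ?U = "V - {u, v}"
  let ?Y = "X \<inter> ?U"
  assume "\<not> ?thesis"
  moreover have "card ?Y \<le> card X" using X(1) by (simp add: card_mono)
  ultimately have small: "card ?Y < (if (u, v) \<in> E then k - 1 else k)" by linarith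
  have no: False if "walk_in E ys" "set ys \<subseteq> ?U - X" "(u, hd ys) \<in> E" "(last ys, v) \<in> E" for ys
  proof -
    have "ys \<noteq> []" using that(1) by (simp add: walk_in_def)
    then have "hd ys \<in> set ys" "last ys \<in> set ys" by auto
    then have "hd ys \<in> ?U" "last ys \<in> ?U" using that(2) by blast+
    moreover have "walk_in (E \<inter> ?U \<times> ?U) ys" using that by (intro walk_restrict) auto
    ultimately have "set ys \<inter> X \<noteq> {}" using X(2) that(3,4) unfolding separates_def by blast
    then show False using that(2) by blast
  qed
  show False
  proof (cases "(u, v) \<in> E")
    case False
    have "\<exists>xs. walk_in E xs \<and> distinct xs \<and> hd xs = u \<and> last xs = v \<and> set xs \<subseteq> V - ?Y"
      by (rule k_connected_path[OF conn]) (use small False uv in auto)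
    then obtain xs where xs: "walk_in E xs" "distinct xs" "hd xs = u" "last xs = v" "set xs \<subseteq> V - ?Y"
      by blast
    then obtain xs' where xs': "xs = u # xs'" "xs' \<noteq> []"
      using uv(3) by (cases xs) (auto simp: walk_in_def split: if_splits)
    then obtain ys where ys: "xs = u # ys @ [v]" using xs(4) by (metis append_butlast_last_id last_ConsR)
    have "ys \<noteq> []" using xs(1) False unfolding ys by (auto simp: walk_in_def)
    then have "walk_in E ys" "(u, hd ys) \<in> E" "(last ys, v) \<in> E"
      using xs(1) unfolding ys by (auto simp: walk_in_def successively_Cons successively_append_iff)
    moreover have "set ys \<subseteq> ?U - X" using xs(2,5) unfolding ys by auto
    ultimately show False using no by blast
  next
    case True
    have "card {u, v} = 2" using uv by simp
    then have "card ?U = card V - 2" using uv by (subst card_Diff_subset) auto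
    \<comment> \<open>This uses \<open>k < card V\<close>: fewer than \<open>k - 1\<close> vertices
      cannot exhaust the \<open>card V - 2\<close> vertices other than \<open>u\<close> and
      \<open>v\<close>.\<close>
    then have "card ?Y < card ?U" using small True conn unfolding k_connected_def by auto
    then obtain w where w: "w \<in> ?U" "w \<notin> X" by (metis IntI less_irrefl subsetI card_mono fin finite_Int finite_Diff Int_lower2 inf.absorb_iff2 inf_commute)
    have cu: "card (insert a ?Y) < k" for a
      using small True X(1) by (auto simp: card_insert_if)
    have "\<exists>xs. walk_in E xs \<and> distinct xs \<and> hd xs = w \<and> last xs = v \<and> set xs \<subseteq> V - insert u ?Y"
      by (rule k_connected_path[OF conn]) (use cu w uv in auto)
    then obtain xs where xs: "walk_in E xs" "distinct xs" "hd xs = w" "last xs = v" "set xs \<subseteq> V - insert u ?Y"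
      by blast
    have "\<exists>xs. walk_in E xs \<and> distinct xs \<and> hd xs = w \<and> last xs = u \<and> set xs \<subseteq> V - insert v ?Y"
      by (rule k_connected_path[OF conn]) (use cu w uv in auto)
    then obtain ys where ys: "walk_in E ys" "distinct ys" "hd ys = w" "last ys = u" "set ys \<subseteq> V - insert v ?Y"
      by blast
    obtain a where a: "xs = w # a @ [v]"
      using xs(1,3,4) w by (cases xs; cases "tl xs" rule: rev_cases) (auto simp: walk_in_def)
    obtain b where b: "ys = w # b @ [u]"
      using ys(1,3,4) w by (cases ys; cases "tl ys" rule: rev_cases) (auto simp: walk_in_def)
    have wa: "walk_in E (w # a)" "(last (w # a), v) \<in> E"
      using xs(1) walk_in_append[of "w # a" "[v]" E] unfolding a by auto
    have wb: "walk_in E (w # b)" "(last (w # b), u) \<in> E"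
      using ys(1) walk_in_append[of "w # b" "[u]" E] unfolding b by auto
    have "walk_in E (rev (w # b))" using wb(1) sym by (simp add: walk_in_rev del: rev.simps)
    then have "walk_in E (rev b @ w # a)" using wa(1) by (subst walk_in_join) simp
    moreover have "set (rev b @ w # a) \<subseteq> ?U - X" using xs(2,5) ys(2,5) w unfolding a b by auto
    moreover have "(u, hd (rev b @ w # a)) \<in> E"
      using symD[OF sym wb(2)] by (cases b rule: rev_cases) auto
    moreover have "(last (rev b @ w # a), v) \<in> E" using wa(2) by simp
    ultimately show False using no by blast
  qed
qed

text \<open>Menger's theorem is applied to the neighbourhoods of \<open>u\<close> and
  \<open>v\<close> after removing both vertices. An arc from \<open>u\<close> to \<open>v\<close>
  supplies one more path, with an empty list of inner vertices; \<open>w i \<noteq> w j\<close> says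
  that this happens at most once, which disjointness alone does not.\<close>

lemma internally_disjoint_paths:
  assumes fin: "finite V" and EV: "E \<subseteq> V \<times> V" and sym: "sym E" and conn: "k_connected V E k"
    and uv: "u \<in> V" "v \<in> V" "u \<noteq> v"
  shows "\<exists>w. (\<forall>i<k. walk_in E (u # w i @ [v]) \<and> distinct (u # w i @ [v])) \<and>
    (\<forall>i<k. \<forall>j<k. i \<noteq> j \<longrightarrow> set (w i) \<inter> set (w j) = {} \<and> w i \<noteq> w j)"
proof -
  let ?U = "V - {u, v}"
  let ?E = "E \<inter> ?U \<times> ?U"
  let ?A = "{x \<in> ?U. (u, x) \<in> E}"
  let ?B = "{x \<in> ?U. (x, v) \<in> E}"
  define l where "l = (if (u, v) \<in> E then k - 1 else k)"
  have "finite E" using fin EV by (meson finite_SigmaI finite_subset)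
  then have "\<exists>p. linkage ?E ?A ?B l p"
    using separator_card[OF fin sym conn uv] fin unfolding l_def by (intro menger_sets) auto
  then obtain p where p: "linkage ?E ?A ?B l p" by blast
  define w where "w i = (if i < l then p i else [])" for i
  have ne: "p i \<noteq> []" if "i < l" for i using p that by (auto simp: linkage_def walk_in_def)
  have sub: "set (p i) \<subseteq> ?U" if "i < l" for i
    using p that walk_subset[of E ?U "p i"] unfolding linkage_def by blast
  have wlk: "walk_in E (u # p i @ [v])" if "i < l" for i
  proof -
    have "walk_in E (p i)" "(u, hd (p i)) \<in> E" "(last (p i), v) \<in> E"
      using p that walk_in_mono[of ?E _ E] unfolding linkage_def by auto
    then show ?thesis using ne[OF that] by (auto simp: walk_in_def successively_Cons successively_append_iff)
  qed
  have edge: "(u, v) \<in> E \<and> i = k - 1" if "i < k" "\<not> i < l" for i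
    using that by (auto simp: l_def split: if_splits)
  show ?thesis
  proof (intro exI[of _ w] conjI allI impI)
    fix i assume i: "i < k"
    show "walk_in E (u # w i @ [v])"
      using wlk[of i] edge[OF i] by (auto simp: w_def walk_in_def)
    show "distinct (u # w i @ [v])"
      using p sub[of i] uv by (auto simp: w_def linkage_def)
  next
    fix i j assume ij: "i < k" "j < k" "i \<noteq> j"
    show "set (w i) \<inter> set (w j) = {}"
      using p ij by (auto simp: w_def linkage_def)
    then show "w i \<noteq> w j"
      using ne[of i] ne[of j] edge[OF ij(1)] edge[OF ij(2)] ij(3) by (auto simp: w_def split: if_splits)
  qed
qed

section \<open>Two systems of internally disjoint paths between three terminals\<close>

text \<open>
  A block consists of a set \<open>K\<close> of terminals and a set \<open>W\<close> of inner vertices. An arc between two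
  terminals is admitted only if \<open>W = {}\<close>, so that two different blocks with disjoint inner vertex sets
  share no arc.
\<close>

definition block_arcs :: "('a \<times> 'a) set \<Rightarrow> 'a set \<Rightarrow> 'a set \<Rightarrow> ('a \<times> 'a) set" where
  "block_arcs E K W =
     {(x, y) \<in> E. x \<in> W \<union> K \<and> y \<in> W \<union> K \<and> (x \<in> K \<longrightarrow> y \<in> K \<longrightarrow> W = {})}"

definition block_connected :: "('a \<times> 'a) set \<Rightarrow> 'a set \<Rightarrow> 'a set \<Rightarrow> bool" where
  "block_connected E K W \<longleftrightarrow> (\<forall>x\<in>W \<union> K. \<forall>y\<in>W \<union> K. (x, y) \<in> (block_arcs E K W)\<^sup>*)"

lemma sym_block_arcs: "sym E \<Longrightarrow> sym (block_arcs E K W)"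
  unfolding block_arcs_def sym_def by blast

lemma walk_in_rtrancl: "walk_in F (x # xs) \<Longrightarrow> y \<in> set xs \<Longrightarrow> (x, y) \<in> F\<^sup>*"
proof (induction xs arbitrary: x)
  case (Cons z xs)
  then have "(x, z) \<in> F" "walk_in F (z # xs)" by (auto simp: walk_in_def)
  then show ?case using Cons by (auto intro: converse_rtrancl_into_rtrancl)
qed simp

lemma walk_into_block:
  assumes "walk_in E (a # xs)" "set xs \<subseteq> W" "a \<in> W \<union> K" "W \<inter> K = {}"
  shows "walk_in (block_arcs E K W) (a # xs)"
  using assms
proof (induction xs arbitrary: a)
  case (Cons x xs)
  then have "walk_in (block_arcs E K W) (x # xs)" by (auto simp: walk_in_def)
  moreover have "(a, x) \<in> block_arcs E K W" using Cons.prems by (auto simp: walk_in_def block_arcs_def)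
  ultimately show ?case by (simp add: walk_in_def)
qed (simp add: walk_in_def)

lemma block_connected_root:
  assumes "sym E" "\<And>x. x \<in> W \<union> K \<Longrightarrow> (r, x) \<in> (block_arcs E K W)\<^sup>*"
  shows "block_connected E K W"
  unfolding block_connected_def
  by (metis assms sym_block_arcs rtrancl_trans sym_rtrancl symD)

lemma block_connected_path:
  assumes "walk_in E (a # xs @ [b])" "sym E" "set xs \<inter> {a, b} = {}"
  shows "block_connected E {a, b} (set xs)"
proof (rule block_connected_root[where r = a])
  have "walk_in (block_arcs E {a, b} (set xs)) (a # xs @ [b])"
  proof (cases "xs = []")
    case True
    then show ?thesis using assms(1) by (auto simp: walk_in_def block_arcs_def)
  next
    case False
    have "walk_in E (a # xs)" "(last (a # xs), b) \<in> E"
      using assms(1) walk_in_append[of "a # xs" "[b]" E] by auto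
    then have "walk_in (block_arcs E {a, b} (set xs)) (a # xs)"
      using assms(3) by (intro walk_into_block) auto
    moreover have "(last xs, b) \<in> block_arcs E {a, b} (set xs)"
      using \<open>(last (a # xs), b) \<in> E\<close> False assms(3) last_in_set[OF False]
      by (auto simp: block_arcs_def)
    ultimately have "walk_in (block_arcs E {a, b} (set xs)) ((a # xs) @ [b])"
      using False by (subst walk_in_append) (auto simp: walk_in_def)
    then show ?thesis by simp
  qed
  then show "(a, x) \<in> (block_arcs E {a, b} (set xs))\<^sup>*" if "x \<in> set xs \<union> {a, b}" for x
    using that walk_in_rtrancl[of _ a "xs @ [b]" x] by (cases "x = a") auto
qed (rule assms(2))

section \<open>Stopping the walks from \<open>v3\<close>\<close>

locale path_systems =
  fixes E :: "('a \<times> 'a) set" and v1 v2 v3 :: 'a and m :: nat and w z :: "nat \<Rightarrow> 'a list"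
  assumes sym: "sym E" and terminals: "v1 \<noteq> v2" "v1 \<noteq> v3" "v2 \<noteq> v3"
    and w_walk: "i < m \<Longrightarrow> walk_in E (v1 # w i @ [v2])"
    and w_distinct: "i < m \<Longrightarrow> distinct (v1 # w i @ [v2])"
    and w_disjoint: "i < m \<Longrightarrow> j < m \<Longrightarrow> i \<noteq> j \<Longrightarrow> set (w i) \<inter> set (w j) = {} \<and> w i \<noteq> w j"
    and z_walk: "i < m \<Longrightarrow> walk_in E (v3 # z i @ [v1])"
    and z_distinct: "i < m \<Longrightarrow> distinct (v3 # z i @ [v1])"
    and z_disjoint: "i < m \<Longrightarrow> j < m \<Longrightarrow> i \<noteq> j \<Longrightarrow> set (z i) \<inter> set (z j) = {} \<and> z i \<noteq> z j"
begin

text \<open>Position \<open>length (z j)\<close> is \<open>v1\<close>, and position \<open>0\<close>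
  already comes after \<open>v3\<close>, so no walk stops in \<open>v3\<close>.\<close>

definition stop :: "(nat \<Rightarrow> nat) \<Rightarrow> nat \<Rightarrow> 'a" where
  "stop s j = (z j @ [v1]) ! s j"

definition stops :: "(nat \<Rightarrow> nat) \<Rightarrow> 'a set" where
  "stops s = insert v3 (stop s ` {..<m})"

definition between :: "(nat \<Rightarrow> nat) \<Rightarrow> 'a \<Rightarrow> bool" where
  "between s x \<longleftrightarrow> (\<exists>i<m. \<exists>a b c. a < b \<and> b < c \<and> c < length (w i) \<and>
     w i ! a \<in> stops s \<and> w i ! b = x \<and> w i ! c \<in> stops s)"

definition on :: "'a \<Rightarrow> bool" where
  "on x \<longleftrightarrow> (\<exists>i<m. x \<in> set (w i))"

text \<open>
  \<open>s j\<close> is the position at which the \<open>j\<close>-th walk from \<open>v3\<close> stops. The terminal \<open>v3\<close> counts as a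
  stop, since it may lie on one of the paths from \<open>v1\<close> to \<open>v2\<close>.
\<close>

definition valid :: "(nat \<Rightarrow> nat) \<Rightarrow> bool" where
  "valid s \<longleftrightarrow> (\<forall>j<m. s j \<le> length (z j) \<and>
     (\<forall>t<s j. z j ! t \<noteq> v2 \<and> (on (z j ! t) \<longrightarrow> between s (z j ! t))))"

lemma w_unique:
  assumes "i < m" "j < m" "a < length (w i)" "b < length (w j)" "w i ! a = w j ! b"
  shows "i = j \<and> a = b"
proof -
  have "i = j" using w_disjoint[of i j] assms by (metis disjoint_iff nth_mem)
  moreover have "distinct (w i)" using w_distinct[OF assms(1)] by simp
  ultimately show ?thesis using assms nth_eq_iff_index_eq by metis
qed

text \<open>The moved stop may have been one of the two outer witnesses. It then lies on the same
  path and is itself between two stops; the one further out is a different vertex and remains a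
  stop.\<close>

lemma between_advance:
  assumes "between s x" and y: "on (stop s j) \<Longrightarrow> between s (stop s j)" and j: "j < m"
  shows "between (s(j := s')) x"
proof -
  obtain i a b c where i: "i < m" and abc: "a < b" "b < c" "c < length (w i)"
    and x: "w i ! b = x" and ac: "w i ! a \<in> stops s" "w i ! c \<in> stops s"
    using assms(1) unfolding between_def by blast
  have keep: "u \<in> stops (s(j := s'))" if "u \<in> stops s" "u \<noteq> stop s j" for u
  proof -
    have "u = v3 \<or> (\<exists>l<m. u = stop s l)" using that(1) by (auto simp: stops_def)
    then show ?thesis
    proof (elim disjE exE conjE)
      fix l assume l: "l < m" "u = stop s l"
      then have "l \<noteq> j" using that(2) by blast
      then have "u = stop (s(j := s')) l" using l by (simp add: stop_def)
      then show ?thesis using l by (auto simp: stops_def)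
    qed (simp add: stops_def)
  qed
  have outer: "\<exists>a' c'. a' < t \<and> t < c' \<and> c' < length (w i) \<and> w i ! a' \<in> stops s \<and> w i ! c' \<in> stops s"
    if "t < length (w i)" "w i ! t = stop s j" for t
  proof -
    have "on (stop s j)" unfolding on_def using i that by (metis nth_mem)
    then obtain i' a' b' c' where i': "i' < m" and abc': "a' < b'" "b' < c'" "c' < length (w i')"
      and x': "w i' ! b' = stop s j" "w i' ! a' \<in> stops s" "w i' ! c' \<in> stops s"
      using y unfolding between_def by blast
    have "i' = i \<and> b' = t" by (rule w_unique) (use i i' abc' x' that in auto)
    then show ?thesis using abc' x' by blast
  qed
  have dist: "w i ! t \<noteq> w i ! u" if "t < u" "u < length (w i)" for t u
    using w_unique[OF i i, of t u] that by auto
  have "\<exists>a'\<le>a. w i ! a' \<in> stops (s(j := s'))"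
  proof (cases "w i ! a = stop s j")
    case True
    then obtain a' where a': "a' < a" "w i ! a' \<in> stops s" using outer[of a] abc by auto
    then have "w i ! a' \<noteq> stop s j" using dist[of a' a] abc True by auto
    then show ?thesis using keep a' by (meson less_imp_le)
  qed (use keep ac in blast)
  moreover have "\<exists>c'\<ge>c. c' < length (w i) \<and> w i ! c' \<in> stops (s(j := s'))"
  proof (cases "w i ! c = stop s j")
    case True
    then obtain c' where c': "c < c'" "c' < length (w i)" "w i ! c' \<in> stops s" using outer[of c] abc by auto
    then have "w i ! c' \<noteq> stop s j" using dist[of c c'] abc True by auto
    then show ?thesis using keep c' by (meson less_imp_le)
  qed (use keep ac abc in blast)
  ultimately obtain a' c' where "a' \<le> a" "c \<le> c'" "c' < length (w i)"
    "w i ! a' \<in> stops (s(j := s'))" "w i ! c' \<in> stops (s(j := s'))" by blast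
  then show ?thesis unfolding between_def using i abc x
    by (intro exI[of _ i] conjI exI[of _ a'] exI[of _ b] exI[of _ c']) auto
qed

text \<open>Take a valid \<open>s\<close> with the greatest sum of positions. A stop other than
  \<open>v1\<close> and \<open>v2\<close> that is off the paths or between two stops could be
  advanced by one, since \<open>between_advance\<close> keeps all crossings permitted.\<close>

lemma stable_stops:
  "\<exists>s. valid s \<and> (\<forall>j<m. stop s j = v1 \<or> stop s j = v2 \<or> on (stop s j) \<and> \<not> between s (stop s j))"
proof -
  let ?f = "\<lambda>s. \<Sum>j<m. s j"
  have "valid (\<lambda>_. 0)" by (simp add: valid_def)
  moreover have "\<forall>s. valid s \<longrightarrow> ?f s < Suc (\<Sum>j<m. length (z j))"
    unfolding valid_def by (intro allI impI le_imp_less_Suc sum_mono) auto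
  ultimately have "\<exists>s. valid s \<and> (\<forall>s'. valid s' \<longrightarrow> ?f s' \<le> ?f s)"
    by (rule ex_has_greatest_nat)
  then obtain s where s: "valid s" and max: "valid s' \<Longrightarrow> ?f s' \<le> ?f s" for s' by blast
  have "stop s j = v1 \<or> stop s j = v2 \<or> on (stop s j) \<and> \<not> between s (stop s j)" if j: "j < m" for j
  proof (rule ccontr)
    assume neg: "\<not> ?thesis"
    then have y: "stop s j \<noteq> v1" "stop s j \<noteq> v2" "on (stop s j) \<Longrightarrow> between s (stop s j)" by auto
    have sj: "s j < length (z j)"
      using s j y(1) by (auto simp: valid_def stop_def nth_append split: if_splits)
    then have sz: "stop s j = z j ! s j" by (simp add: stop_def nth_append)
    let ?s = "s(j := Suc (s j))"
    have adv: "between s x \<Longrightarrow> between ?s x" for x using between_advance y(3) j by blast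
    have "valid ?s"
      unfolding valid_def
    proof (intro allI impI conjI)
      fix l assume l: "l < m"
      show "?s l \<le> length (z l)" using s l sj by (auto simp: valid_def)
      fix t assume t: "t < ?s l"
      have "(t = s j \<and> l = j) \<or> t < s l" using t by (auto split: if_splits)
      then show "z l ! t \<noteq> v2" using y(2) sz s l by (auto simp: valid_def)
      assume "on (z l ! t)"
      with \<open>(t = s j \<and> l = j) \<or> t < s l\<close> have "between s (z l ! t)"
        using y(3) sz s l by (auto simp: valid_def)
      then show "between ?s (z l ! t)" by (rule adv)
    qed
    moreover have "?f s < ?f ?s" using j by (intro sum_strict_mono_ex1) auto
    ultimately show False using max by fastforce
  qed
  then show ?thesis using s by blast
qed

end

text \<open>Being a set of pairs, the system has for each \<open>K\<close> at most one block without
  inner vertices. Together with the condition for \<open>K = S\<close>, an arc between terminals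
  then belongs to at most one block, provided that all blocks have two or three terminals.\<close>

definition block_system :: "('a \<times> 'a) set \<Rightarrow> 'a set \<Rightarrow> ('a set \<times> 'a set) set \<Rightarrow> bool" where
  "block_system E S B \<longleftrightarrow> finite B \<and>
     (\<forall>(K, W)\<in>B. K \<subseteq> S \<and> W \<inter> S = {} \<and> block_connected E K W \<and> (K = S \<longrightarrow> W \<noteq> {})) \<and>
     (\<forall>b\<in>B. \<forall>b'\<in>B. b \<noteq> b' \<longrightarrow> snd b \<inter> snd b' = {})"

text \<open>
  \<open>Through i\<close>, \<open>Claw i\<close>, \<open>Lower i\<close> and \<open>Upper i\<close> name the blocks arising from the \<open>i\<close>-th path from \<open>v1\<close> to
  \<open>v2\<close> when it has no stop, a single stop, or is split (into the part at \<open>v1\<close> and the part at \<open>v2\<close>);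
  \<open>Direct j\<close> names the \<open>j\<close>-th walk from \<open>v3\<close> when it reaches \<open>v1\<close> or \<open>v2\<close>.
\<close>

datatype label = Through nat | Claw nat | Lower nat | Upper nat | Direct nat

lemma walk_in_prefix: "walk_in E (xs @ ys) \<Longrightarrow> xs \<noteq> [] \<Longrightarrow> walk_in E xs"
  by (auto simp: walk_in_def successively_append_iff)

lemma walk_in_suffix: "walk_in E (xs @ ys) \<Longrightarrow> ys \<noteq> [] \<Longrightarrow> walk_in E ys"
  by (auto simp: walk_in_def successively_append_iff)

lemma walk_in_split:
  assumes "walk_in E (a # xs @ [b])" "n < length xs"
  shows "walk_in E (a # take n xs @ [xs ! n])" "walk_in E (xs ! n # drop (Suc n) xs @ [b])"
proof -
  have "(a # take n xs) @ xs ! n # (drop (Suc n) xs @ [b]) = a # (take n xs @ xs ! n # drop (Suc n) xs) @ [b]"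
    by simp
  also have "\<dots> = a # xs @ [b]" using id_take_nth_drop[OF assms(2)] by metis
  finally have "walk_in E ((a # take n xs) @ xs ! n # (drop (Suc n) xs @ [b]))" using assms(1) by metis
  then show "walk_in E (a # take n xs @ [xs ! n])" "walk_in E (xs ! n # drop (Suc n) xs @ [b])"
    by (subst (asm) walk_in_join, simp)+
qed

section \<open>The blocks cut out by a stable system of stops, and their disjointness\<close>

locale stable_paths = path_systems +
  fixes s :: "nat \<Rightarrow> nat"
  assumes valid: "valid s"
    and stable: "j < m \<Longrightarrow> stop s j = v1 \<or> stop s j = v2 \<or> on (stop s j) \<and> \<not> between s (stop s j)"
begin

abbreviation end_of :: "nat \<Rightarrow> 'a" where "end_of j \<equiv> stop s j"

definition pre :: "nat \<Rightarrow> 'a list" where "pre j = take (s j) (z j)"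

text \<open>The stop is an inner vertex of the block; for a walk in \<open>D1\<close> or
  \<open>D2\<close> it is a terminal and left out.\<close>

definition leg :: "nat \<Rightarrow> 'a set" where "leg j = set (pre j) \<union> ({end_of j} - {v1, v2})"

definition hits :: "nat \<Rightarrow> nat set" where "hits i = {a. a < length (w i) \<and> w i ! a \<in> stops s}"

definition lo :: "nat \<Rightarrow> nat" where "lo i = Min (hits i)"
definition hi :: "nat \<Rightarrow> nat" where "hi i = Max (hits i)"

text \<open>A path whose only stop is \<open>v3\<close> is not a claw: it splits at
  \<open>v3\<close>, with \<open>lo i = hi i\<close> and no leg on either side, and so falls into
  \<open>I2\<close>.\<close>

definition single :: "nat \<Rightarrow> bool" where "single i \<longleftrightarrow> (\<exists>a. hits i = {a} \<and> w i ! a \<noteq> v3)"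

definition I0 :: "nat set" where "I0 = {i. i < m \<and> hits i = {}}"
definition I1 :: "nat set" where "I1 = {i. i < m \<and> single i}"
definition I2 :: "nat set" where "I2 = {i. i < m \<and> hits i \<noteq> {} \<and> \<not> single i}"
definition D1 :: "nat set" where "D1 = {j. j < m \<and> end_of j = v1}"
definition D2 :: "nat set" where "D2 = {j. j < m \<and> end_of j = v2}"

definition labels :: "label set" where
  "labels = Through ` I0 \<union> Claw ` I1 \<union> Lower ` I2 \<union> Upper ` I2 \<union> Direct ` (D1 \<union> D2)"

text \<open>At most one element unless \<open>x\<close> is \<open>v1\<close>, and none at
  \<open>v3\<close>; a set lets a hit in \<open>v3\<close> contribute no leg without a case
  distinction.\<close>

definition users :: "'a \<Rightarrow> nat set" where "users x = {j. j < m \<and> end_of j = x}"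

fun part :: "label \<Rightarrow> 'a set" where
  "part (Through i) = set (w i)"
| "part (Claw i) = set (w i) - {w i ! lo i}"
| "part (Lower i) = set (take (lo i) (w i))"
| "part (Upper i) = set (drop (Suc (hi i)) (w i))"
| "part (Direct j) = {}"

fun legs :: "label \<Rightarrow> nat set" where
  "legs (Through i) = {}"
| "legs (Claw i) = users (w i ! lo i)"
| "legs (Lower i) = users (w i ! lo i)"
| "legs (Upper i) = users (w i ! hi i)"
| "legs (Direct j) = {j}"

fun ends :: "label \<Rightarrow> 'a set" where
  "ends (Through i) = {v1, v2}"
| "ends (Claw i) = {v1, v2, v3}"
| "ends (Lower i) = {v1, v3}"
| "ends (Upper i) = {v2, v3}"
| "ends (Direct j) = {end_of j, v3}"

definition body :: "label \<Rightarrow> 'a set" where "body b = part b \<union> \<Union> (leg ` legs b)"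

definition blk :: "label \<Rightarrow> 'a set \<times> 'a set" where "blk b = (ends b, body b)"

lemma end_of_cases:
  assumes "j < m"
  obtains (v1) "end_of j = v1" "s j = length (z j)"
  | (z) "end_of j = z j ! s j" "s j < length (z j)" "end_of j \<in> set (z j)" "end_of j \<noteq> v1" "end_of j \<noteq> v3"
proof (cases "s j < length (z j)")
  case True
  then have "end_of j = z j ! s j" by (simp add: stop_def nth_append)
  moreover from this True have "end_of j \<in> set (z j)" by simp
  ultimately show thesis using True z_distinct[OF assms] by (intro z) auto
next
  case False
  then have "s j = length (z j)" using valid assms by (auto simp: valid_def)
  then show thesis by (intro v1) (auto simp: stop_def)
qed

lemma end_of_ne: "j < m \<Longrightarrow> end_of j \<noteq> v3"
  by (erule end_of_cases) (use terminals in auto)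

lemma pre_terminals: "j < m \<Longrightarrow> set (pre j) \<inter> {v1, v2, v3} = {}"
proof -
  assume j: "j < m"
  have "x \<notin> {v1, v2, v3}" if x: "x \<in> set (pre j)" for x
  proof -
    obtain t where "t < s j" "x = z j ! t" using x by (auto simp: pre_def in_set_conv_nth)
    then have "x \<noteq> v2" using valid j by (auto simp: valid_def)
    moreover have "x \<in> set (z j)" using x by (auto simp: pre_def dest: in_set_takeD)
    ultimately show ?thesis using z_distinct[OF j] by auto
  qed
  then show ?thesis by blast
qed

lemma leg_terminals: "j < m \<Longrightarrow> leg j \<inter> {v1, v2, v3} = {}"
  using pre_terminals[of j] end_of_ne[of j] by (auto simp: leg_def)

lemma leg_sub: "j < m \<Longrightarrow> leg j \<subseteq> set (z j)"
  by (erule end_of_cases) (auto simp: leg_def pre_def dest: in_set_takeD)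

lemma leg_disjoint: "j < m \<Longrightarrow> j' < m \<Longrightarrow> j \<noteq> j' \<Longrightarrow> leg j \<inter> leg j' = {}"
  using leg_sub z_disjoint by blast

lemma end_of_inj:
  assumes "j < m" "j' < m" "end_of j = end_of j'" "end_of j \<noteq> v1"
  shows "j = j'"
proof -
  have "end_of j \<in> set (z j)" "end_of j' \<in> set (z j')"
    using assms by (auto elim: end_of_cases)
  then show ?thesis using z_disjoint[OF assms(1,2)] assms(3) by auto
qed

lemma leg_walk: "j < m \<Longrightarrow> walk_in E (v3 # pre j @ [end_of j])"
proof -
  assume j: "j < m"
  have "s j < length (z j @ [v1])" using valid j by (auto simp: valid_def)
  then have eq: "take (Suc (s j)) (z j @ [v1]) = pre j @ [end_of j]"
    using valid j by (simp only: take_Suc_conv_app_nth) (auto simp: stop_def pre_def valid_def)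
  have "walk_in E (v3 # take (Suc (s j)) (z j @ [v1]) @ drop (Suc (s j)) (z j @ [v1]))"
    using z_walk[OF j] by (simp del: append_take_drop_id drop_append take_append add: append_take_drop_id)
  then have "walk_in E ((v3 # pre j @ [end_of j]) @ drop (Suc (s j)) (z j @ [v1]))"
    by (simp only: eq append_Cons append_assoc)
  then show ?thesis by (rule walk_in_prefix) simp
qed

lemma finite_hits: "finite (hits i)"
  by (auto simp: hits_def)

lemma lo_hi:
  assumes "hits i \<noteq> {}"
  shows "lo i \<in> hits i" "hi i \<in> hits i" "a \<in> hits i \<Longrightarrow> lo i \<le> a \<and> a \<le> hi i"
  using assms finite_hits by (auto simp: lo_def hi_def)

text \<open>A vertex before the stop that lies on a path is between two stops by validity, and the
  stop itself is a hit. This is the purpose of the stopping rule.\<close>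

lemma leg_inner:
  assumes "i < m" "a < length (w i)" "j < m" "w i ! a \<in> leg j"
  shows "hits i \<noteq> {} \<and> lo i \<le> a \<and> a \<le> hi i"
proof -
  have "\<exists>l\<in>hits i. \<exists>h\<in>hits i. l \<le> a \<and> a \<le> h"
  proof (cases "w i ! a \<in> set (pre j)")
    case True
    then obtain t where t: "t < s j" "w i ! a = z j ! t"
      by (auto simp: pre_def in_set_conv_nth)
    moreover have "on (w i ! a)" using assms by (auto simp: on_def)
    ultimately have "between s (w i ! a)" using valid assms(3) by (auto simp: valid_def)
    then obtain i' l a' h where "i' < m" "l < a'" "a' < h" "h < length (w i')"
      "w i' ! l \<in> stops s" "w i' ! a' = w i ! a" "w i' ! h \<in> stops s"
      unfolding between_def by blast
    moreover from this have "i' = i \<and> a' = a" using assms by (intro w_unique) auto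
    ultimately have "l \<in> hits i" "h \<in> hits i" "l \<le> a" "a \<le> h" by (auto simp: hits_def)
    then show ?thesis by blast
  next
    case False
    then have "w i ! a = end_of j" using assms(4) by (auto simp: leg_def)
    then have "a \<in> hits i" using assms by (auto simp: hits_def stops_def)
    then show ?thesis by blast
  qed
  then obtain l h where "l \<in> hits i" "h \<in> hits i" "l \<le> a" "a \<le> h" by blast
  moreover from this have "hits i \<noteq> {}" by blast
  ultimately show ?thesis using lo_hi(3)[of i l] lo_hi(3)[of i h] by auto
qed

lemma w_terminals: "i < m \<Longrightarrow> a < length (w i) \<Longrightarrow> w i ! a \<noteq> v1 \<and> w i ! a \<noteq> v2"
  using w_distinct[of i] nth_mem[of a "w i"] by auto

lemma in_I:
  "i \<in> I0 \<Longrightarrow> i < m \<and> hits i = {}"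
  "i \<in> I1 \<Longrightarrow> i < m \<and> hits i = {lo i} \<and> w i ! lo i \<noteq> v3"
  "i \<in> I2 \<Longrightarrow> i < m \<and> hits i \<noteq> {}"
proof -
  show "i \<in> I1 \<Longrightarrow> i < m \<and> hits i = {lo i} \<and> w i ! lo i \<noteq> v3"
    unfolding I1_def single_def lo_def by (elim CollectE conjE exE) simp
qed (simp_all add: I0_def I2_def)

fun index :: "label \<Rightarrow> nat" where
  "index (Through i) = i" | "index (Claw i) = i" | "index (Lower i) = i" | "index (Upper i) = i" | "index (Direct j) = j"

text \<open>One description for all kinds of parts: they avoid the range from the first to the last
  hit, where the legs may run. The last clause separates \<open>Lower\<close> from
  \<open>Upper\<close> on the same path.\<close>

lemma part_position:
  assumes "b \<in> labels" "x \<in> part b"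
  obtains a where "index b < m" "a < length (w (index b))" "x = w (index b) ! a"
    "\<not> (hits (index b) \<noteq> {} \<and> lo (index b) \<le> a \<and> a \<le> hi (index b))"
    "(case b of Lower i \<Rightarrow> a < lo i | Upper i \<Rightarrow> hi i < a | _ \<Rightarrow> True)"
proof (cases b)
  case (Through i)
  then show thesis using assms in_I(1)[of i] that by (auto simp: labels_def in_set_conv_nth)
next
  case (Claw i)
  then have i: "i < m" "hits i = {lo i}" using assms in_I(2)[of i] by (auto simp: labels_def)
  then have "hi i = lo i" by (metis finite_hits hi_def Max_singleton)
  moreover obtain a where "a < length (w i)" "x = w i ! a" "a \<noteq> lo i"
    using assms(2) Claw by (auto simp: in_set_conv_nth)
  ultimately show thesis using that[of a] Claw i by auto
next
  case (Lower i)
  then have "i < m" "hits i \<noteq> {}" using assms in_I(3)[of i] by (auto simp: labels_def)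
  moreover obtain a where "a < lo i" "a < length (w i)" "x = w i ! a"
    using assms(2) Lower by (auto simp: in_set_conv_nth)
  ultimately show thesis using that[of a] Lower by auto
next
  case (Upper i)
  then have "i < m" "hits i \<noteq> {}" using assms in_I(3)[of i] by (auto simp: labels_def)
  moreover obtain a where "a < length (w i) - Suc (hi i)" "x = w i ! (Suc (hi i) + a)"
    using assms(2) Upper by (auto simp: in_set_conv_nth)
  ultimately show thesis using that[of "Suc (hi i) + a"] Upper by auto
qed (use assms in auto)

lemma part_terminals:
  assumes "b \<in> labels" "x \<in> part b"
  shows "x \<notin> {v1, v2, v3}"
proof -
  obtain a where a: "index b < m" "a < length (w (index b))" "x = w (index b) ! a"
    "\<not> (hits (index b) \<noteq> {} \<and> lo (index b) \<le> a \<and> a \<le> hi (index b))"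
    using part_position[OF assms] by metis
  have "a \<notin> hits (index b)" using a(4) lo_hi(3) by blast
  then have "x \<noteq> v3" using a by (auto simp: hits_def stops_def)
  then show ?thesis using w_terminals a by auto
qed

lemma legs_bound: "b \<in> labels \<Longrightarrow> j \<in> legs b \<Longrightarrow> j < m"
  by (auto simp: labels_def users_def D1_def D2_def)

lemma body_terminals: "b \<in> labels \<Longrightarrow> body b \<inter> {v1, v2, v3} = {}"
  using part_terminals[of b] leg_terminals[OF legs_bound[of b]] unfolding body_def by fast

lemma lo_hi_length:
  assumes "hits i \<noteq> {}"
  shows "lo i < length (w i)" "hi i < length (w i)" "w i ! lo i \<in> stops s" "w i ! hi i \<in> stops s"
  using lo_hi(1,2)[OF assms] by (auto simp: hits_def)

text \<open>A common user would force a single hit, different from \<open>v3\<close> because no walk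
  stops there; such a path is a claw.\<close>

lemma Lower_Upper_distinct:
  assumes i: "i \<in> I2"
  shows "users (w i ! lo i) \<inter> users (w i ! hi i) = {}"
proof (rule ccontr)
  assume "users (w i ! lo i) \<inter> users (w i ! hi i) \<noteq> {}"
  then obtain j where j: "j < m" "end_of j = w i ! lo i" "end_of j = w i ! hi i"
    by (auto simp: users_def)
  have ne: "i < m" "hits i \<noteq> {}" using in_I(3)[OF i] by auto
  have "w i ! lo i = w i ! hi i" using j(2,3) by (rule subst)
  then have "lo i = hi i"
    using w_unique[OF ne(1) ne(1) lo_hi_length(1,2)[OF ne(2)]] by blast
  have "hits i \<subseteq> {lo i}"
  proof
    fix a assume "a \<in> hits i"
    then show "a \<in> {lo i}" using lo_hi(3)[OF ne(2), of a] \<open>lo i = hi i\<close> by simp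
  qed
  then have "hits i = {lo i}" using ne(2) by blast
  moreover have "w i ! lo i \<noteq> v3" using end_of_ne[OF j(1)] j(2) by simp
  ultimately show False using i by (auto simp: I2_def single_def)
qed

lemma users_lo_hi:
  assumes "hits i \<noteq> {}" "i < m" "hits i' \<noteq> {}" "i' < m" "i \<noteq> i'"
    "x \<in> {w i ! lo i, w i ! hi i}" "x' \<in> {w i' ! lo i', w i' ! hi i'}"
  shows "users x \<inter> users x' = {}"
proof -
  have "x \<noteq> x'" using assms lo_hi_length[OF assms(1)] lo_hi_length[OF assms(3)] w_unique[of i i'] by blast
  then show ?thesis by (auto simp: users_def)
qed

lemma users_terminal:
  assumes "hits i \<noteq> {}" "i < m" "x \<in> {w i ! lo i, w i ! hi i}" "j \<in> D1 \<union> D2"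
  shows "j \<notin> users x"
proof -
  have "x \<noteq> v1 \<and> x \<noteq> v2"
    using assms(3) lo_hi_length(1,2)[OF assms(1)] w_terminals[OF assms(2)] by (elim insertE emptyE) simp_all
  then show ?thesis using assms(4) by (auto simp: users_def D1_def D2_def)
qed

lemma legs_cases:
  assumes "b \<in> labels" "j \<in> legs b"
  obtains (Claw) i where "b = Claw i" "i \<in> I1" "j \<in> users (w i ! lo i)"
  | (Lower) i where "b = Lower i" "i \<in> I2" "j \<in> users (w i ! lo i)"
  | (Upper) i where "b = Upper i" "i \<in> I2" "j \<in> users (w i ! hi i)"
  | (Direct) "b = Direct j" "j \<in> D1 \<union> D2"
  using assms by (cases b) (auto simp: labels_def)

text \<open>A stop lies on at most one \<open>v1\<close>-\<open>v2\<close> path and so determines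
  the index; on one path only \<open>Lower\<close> and \<open>Upper\<close> can compete, which
  \<open>Lower_Upper_distinct\<close> excludes.\<close>

lemma legs_disjoint:
  assumes b: "b \<in> labels" "b' \<in> labels" "b \<noteq> b'"
  shows "legs b \<inter> legs b' = {}"
proof (rule ccontr)
  assume "legs b \<inter> legs b' \<noteq> {}"
  then obtain j where j: "j \<in> legs b" "j \<in> legs b'" by blast
  have anchored: "b = Direct j \<and> j \<in> D1 \<union> D2 \<or> index b < m \<and> hits (index b) \<noteq> {} \<and>
      (\<exists>x\<in>{w (index b) ! lo (index b), w (index b) ! hi (index b)}. j \<in> users x)"
    if "b \<in> labels" "j \<in> legs b" for b
    using that by (rule legs_cases) (use in_I(2,3) in \<open>auto simp del: insert_iff\<close>)
  have nD: "a \<noteq> Direct j" if "a \<in> {b, b'}" for a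
  proof
    assume a: "a = Direct j"
    then have "j \<in> D1 \<union> D2" using that b by (auto simp: labels_def)
    then have "b = Direct j" "b' = Direct j"
      using anchored[OF b(1) j(1)] anchored[OF b(2) j(2)] users_terminal by blast+
    then show False using b(3) by simp
  qed
  then have "b \<noteq> Direct j" "b' \<noteq> Direct j" by auto
  moreover from this have "index b = index b'"
    using anchored[OF b(1) j(1)] anchored[OF b(2) j(2)] users_lo_hi[of "index b" "index b'"] by blast
  ultimately have same: "index b = index b'" "\<not> b = Direct j" "\<not> b' = Direct j" by auto
  have c: "i \<notin> I2" if "i \<in> I1" for i using that by (auto simp: I1_def I2_def)
  show False
    using b(1) j(1)
  proof (cases rule: legs_cases)
    case 1: (Claw i)
    show ?thesis using b(2) j(2) by (cases rule: legs_cases) (use 1 same c b(3) in auto)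
  next
    case 1: (Lower i)
    show ?thesis using b(2) j(2)
      by (cases rule: legs_cases) (use 1 same c b(3) Lower_Upper_distinct[of i] in auto)
  next
    case 1: (Upper i)
    show ?thesis using b(2) j(2)
      by (cases rule: legs_cases) (use 1 same c b(3) Lower_Upper_distinct[of i] in auto)
  qed (use same in auto)
qed

lemma labels_iff:
  "Through i \<in> labels \<longleftrightarrow> i \<in> I0" "Claw i \<in> labels \<longleftrightarrow> i \<in> I1" "Lower i \<in> labels \<longleftrightarrow> i \<in> I2"
  "Upper i \<in> labels \<longleftrightarrow> i \<in> I2" "Direct i \<in> labels \<longleftrightarrow> i \<in> D1 \<union> D2"
  by (auto simp: labels_def)

lemma I_disjoint: "I0 \<inter> I1 = {}" "I0 \<inter> I2 = {}" "I1 \<inter> I2 = {}" "I0 \<union> I1 \<union> I2 = {..<m}"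
  by (auto simp: I0_def I1_def I2_def single_def)

lemma part_disjoint:
  assumes b: "b \<in> labels" "b' \<in> labels" "b \<noteq> b'"
  shows "part b \<inter> part b' = {}"
proof (rule ccontr)
  assume "part b \<inter> part b' \<noteq> {}"
  then obtain x where x: "x \<in> part b" "x \<in> part b'" by blast
  obtain a where a: "index b < m" "a < length (w (index b))" "x = w (index b) ! a"
    "case b of Lower i \<Rightarrow> a < lo i | Upper i \<Rightarrow> hi i < a | _ \<Rightarrow> True"
    using part_position[OF b(1) x(1)] by metis
  obtain a' where a': "index b' < m" "a' < length (w (index b'))" "x = w (index b') ! a'"
    "case b' of Lower i \<Rightarrow> a' < lo i | Upper i \<Rightarrow> hi i < a' | _ \<Rightarrow> True"
    using part_position[OF b(2) x(2)] by metis
  have same: "index b = index b' \<and> a = a'"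
    by (rule w_unique) (use a a' in auto)
  have le: "\<not> hi i < c" if "i \<in> I2" "c < lo i" for i c
    using lo_hi(3)[OF _ lo_hi(1), of i] in_I(3)[OF that(1)] that(2) by fastforce
  have nodirect: "b \<noteq> Direct j" "b' \<noteq> Direct j" for j using x by auto
  have dis: "i \<in> I0 \<Longrightarrow> i \<notin> I1 \<and> i \<notin> I2" "i \<in> I1 \<Longrightarrow> i \<notin> I2" for i using I_disjoint(1-3) by blast+
  show False
    using b same a(4) a'(4) nodirect
    by (cases b; cases b') (auto simp: labels_iff dest: dis le)
qed

lemma part_leg:
  assumes "b \<in> labels" "j < m"
  shows "part b \<inter> leg j = {}"
proof (rule ccontr)
  assume "part b \<inter> leg j \<noteq> {}"
  then obtain x where x: "x \<in> part b" "x \<in> leg j" by blast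
  obtain a where a: "index b < m" "a < length (w (index b))" "x = w (index b) ! a"
    "\<not> (hits (index b) \<noteq> {} \<and> lo (index b) \<le> a \<and> a \<le> hi (index b))"
    using part_position[OF assms(1) x(1)] by metis
  then show False using leg_inner[OF a(1,2) assms(2)] x(2) by blast
qed

lemma body_disjoint:
  assumes b: "b \<in> labels" "b' \<in> labels" "b \<noteq> b'"
  shows "body b \<inter> body b' = {}"
proof (rule ccontr)
  assume "body b \<inter> body b' \<noteq> {}"
  then obtain x where x: "x \<in> body b" "x \<in> body b'" by blast
  have "x \<in> part b \<or> (\<exists>j\<in>legs b. x \<in> leg j)" "x \<in> part b' \<or> (\<exists>j\<in>legs b'. x \<in> leg j)"
    using x by (auto simp: body_def)
  then show False
  proof (elim disjE bexE)
    show ?thesis if "x \<in> part b" "x \<in> part b'" using part_disjoint[OF b] that by blast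
    show ?thesis if "x \<in> part b" "j \<in> legs b'" "x \<in> leg j" for j
      using part_leg[OF b(1) legs_bound[OF b(2) that(2)]] that by blast
    show ?thesis if "x \<in> part b'" "j \<in> legs b" "x \<in> leg j" for j
      using part_leg[OF b(2) legs_bound[OF b(1) that(2)]] that by blast
    show ?thesis if j: "j \<in> legs b" "x \<in> leg j" "j' \<in> legs b'" "x \<in> leg j'" for j j'
    proof -
      have "j \<noteq> j'" using legs_disjoint[OF b] j by blast
      then show ?thesis
        using leg_disjoint[OF legs_bound[OF b(1) j(1)] legs_bound[OF b(2) j(3)]] j by blast
    qed
  qed
qed

section \<open>Connectedness of the blocks\<close>

lemma users_leg:
  assumes "x \<in> stops s" "x \<noteq> v1" "x \<noteq> v2"
  obtains (terminal) "x = v3" "users x = {}"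
  | (path) j where "j < m" "x = end_of j" "users x = {j}" "leg j = insert x (set (pre j))"
proof (cases "x = v3")
  case True
  then show thesis using end_of_ne by (intro terminal) (auto simp: users_def)
next
  case False
  then obtain j where j: "j < m" "x = end_of j" using assms(1) by (auto simp: stops_def)
  moreover have "users x = {j}" using j assms(2) end_of_inj by (fastforce simp: users_def)
  moreover have "leg j = insert x (set (pre j))" using j(2) assms by (auto simp: leg_def)
  ultimately show thesis by (rule path)
qed

text \<open>From a hit, \<open>v3\<close> is reached along the reversed leg of the walk that stops
  there, or without any step if the hit is \<open>v3\<close>. This treats both cases of
  \<open>Lower\<close> and \<open>Upper\<close> at once.\<close>

lemma access:
  assumes "x \<in> stops s" "x \<noteq> v1" "x \<noteq> v2"
  obtains l where "walk_in E (x # l)" "last (x # l) = v3" "set (butlast (x # l)) = \<Union> (leg ` users x)"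
  using assms
proof (cases rule: users_leg)
  case terminal
  then show thesis by (intro that[of "[]"]) (auto simp: walk_in_def)
next
  case (path j)
  have "walk_in E (rev (v3 # pre j @ [end_of j]))"
    using leg_walk[OF path(1)] by (subst walk_in_rev[OF sym])
  then show thesis using path by (intro that[of "rev (pre j) @ [v3]"]) (auto simp: butlast_append)
qed

lemma hit_stop: "i \<in> I1 \<union> I2 \<Longrightarrow> x \<in> {w i ! lo i, w i ! hi i} \<Longrightarrow> x \<in> stops s \<and> x \<noteq> v1 \<and> x \<noteq> v2"
proof -
  assume i: "i \<in> I1 \<union> I2" and x: "x \<in> {w i ! lo i, w i ! hi i}"
  then have h: "i < m" "hits i \<noteq> {}" using in_I(2,3)[of i] by auto
  show ?thesis
    using x lo_hi_length[OF h(2)] w_terminals[OF h(1)] by (elim insertE emptyE) simp_all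
qed

lemma Lower_connected:
  assumes "i \<in> I2"
  shows "block_connected E {v1, v3} (body (Lower i))"
proof -
  let ?x = "w i ! lo i"
  have i: "i < m" "hits i \<noteq> {}" using in_I(3)[OF assms] by auto
  note len = lo_hi_length[OF i(2)]
  have st: "?x \<in> stops s" "?x \<noteq> v1" "?x \<noteq> v2" using hit_stop[of i ?x] assms by auto
  obtain l where l: "walk_in E (?x # l)" "last (?x # l) = v3" "set (butlast (?x # l)) = \<Union> (leg ` users ?x)"
    using access[OF st] by metis
  let ?p = "take (lo i) (w i) @ butlast (?x # l)"
  have "walk_in E (v1 # take (lo i) (w i) @ [?x])" by (rule walk_in_split(1)[OF w_walk[OF i(1)] len(1)])
  then have "walk_in E ((v1 # take (lo i) (w i)) @ ?x # l)"
    using l(1) by (subst walk_in_join) simp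
  moreover have "(v1 # take (lo i) (w i)) @ ?x # l = v1 # ?p @ [v3]"
    using l(2) by (metis append_Cons append_assoc append_butlast_last_id list.distinct(1))
  ultimately have "walk_in E (v1 # ?p @ [v3])" by simp
  moreover have p: "set ?p = body (Lower i)" using l(3) by (auto simp: body_def)
  moreover have "body (Lower i) \<inter> {v1, v3} = {}"
    using body_terminals[of "Lower i"] assms by (auto simp: labels_iff)
  ultimately show ?thesis using block_connected_path[of E v1 ?p v3] sym by simp
qed

lemma Upper_connected:
  assumes "i \<in> I2"
  shows "block_connected E {v2, v3} (body (Upper i))"
proof -
  let ?x = "w i ! hi i"
  have i: "i < m" "hits i \<noteq> {}" using in_I(3)[OF assms] by auto
  note len = lo_hi_length[OF i(2)]
  have st: "?x \<in> stops s" "?x \<noteq> v1" "?x \<noteq> v2" using hit_stop[of i ?x] assms by auto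
  obtain l where l: "walk_in E (?x # l)" "last (?x # l) = v3" "set (butlast (?x # l)) = \<Union> (leg ` users ?x)"
    using access[OF st] by metis
  let ?d = "drop (Suc (hi i)) (w i)"
  let ?p = "rev ?d @ butlast (?x # l)"
  have "walk_in E (?x # ?d @ [v2])" by (rule walk_in_split(2)[OF w_walk[OF i(1)] len(2)])
  then have "walk_in E (rev (?x # ?d @ [v2]))" by (subst walk_in_rev[OF sym])
  then have "walk_in E (v2 # rev ?d @ [?x])" by simp
  then have "walk_in E ((v2 # rev ?d) @ ?x # l)"
    using l(1) by (subst walk_in_join) simp
  moreover have "(v2 # rev ?d) @ ?x # l = v2 # ?p @ [v3]"
    using l(2) by (metis append_Cons append_assoc append_butlast_last_id list.distinct(1))
  ultimately have "walk_in E (v2 # ?p @ [v3])" by simp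
  moreover have p: "set ?p = body (Upper i)" using l(3) by (auto simp: body_def)
  moreover have "body (Upper i) \<inter> {v2, v3} = {}"
    using body_terminals[of "Upper i"] assms by (auto simp: labels_iff)
  ultimately show ?thesis using block_connected_path[of E v2 ?p v3] sym by simp
qed

lemma Claw_body:
  assumes "i \<in> I1"
  obtains j where "j < m" "w i ! lo i = end_of j" "body (Claw i) = set (w i) \<union> set (pre j)" "w i ! lo i \<in> set (w i)"
proof -
  let ?x = "w i ! lo i"
  have i: "i < m" "hits i \<noteq> {}" "?x \<noteq> v3" using in_I(2)[OF assms] by auto
  have st: "?x \<in> stops s" "?x \<noteq> v1" "?x \<noteq> v2" using hit_stop[of i ?x] assms by auto
  have xin: "?x \<in> set (w i)" using lo_hi_length[OF i(2)] by simp
  from st show thesis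
  proof (cases rule: users_leg)
    case (path j)
    then show thesis using xin by (intro that[of j]) (auto simp: body_def)
  qed (use i in simp)
qed

text \<open>The walks along the path from \<open>v1\<close> and from \<open>v2\<close> and the leg
  from \<open>v3\<close> all pass through the only hit.\<close>

lemma Claw_connected:
  assumes "i \<in> I1"
  shows "block_connected E {v1, v2, v3} (body (Claw i))"
proof -
  let ?x = "w i ! lo i"
  let ?K = "{v1, v2, v3}"
  obtain j where j: "j < m" "?x = end_of j" "body (Claw i) = set (w i) \<union> set (pre j)" "?x \<in> set (w i)"
    using Claw_body[OF assms] by metis
  have i: "i < m" using in_I(2)[OF assms] by auto
  have disj: "body (Claw i) \<inter> ?K = {}" using body_terminals[of "Claw i"] assms by (auto simp: labels_iff)
  let ?F = "block_arcs E ?K (body (Claw i))"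
  have sF: "sym ?F" by (rule sym_block_arcs[OF sym])
  have "walk_in E ((v1 # w i) @ [v2])" using w_walk[OF i] by simp
  then have "walk_in E (v1 # w i)" by (rule walk_in_prefix) simp
  then have 1: "walk_in ?F (v1 # w i)" using j(3) disj by (intro walk_into_block) auto
  have "walk_in E ([v1] @ (w i @ [v2]))" using w_walk[OF i] by simp
  then have "walk_in E (w i @ [v2])" by (rule walk_in_suffix) simp
  then have "walk_in E (rev (w i @ [v2]))" by (subst walk_in_rev[OF sym])
  then have "walk_in E (v2 # rev (w i))" by simp
  then have 2: "walk_in ?F (v2 # rev (w i))" using j(3) disj by (intro walk_into_block) auto
  have "walk_in E (v3 # pre j @ [?x])" using leg_walk[OF j(1)] j(2) by simp
  then have 3: "walk_in ?F (v3 # pre j @ [?x])" using j(3,4) disj by (intro walk_into_block) auto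
  have t1: "(v1, u) \<in> ?F\<^sup>*" if "u \<in> insert v1 (set (w i))" for u using walk_in_rtrancl[OF 1] that by auto
  have t2: "(v2, u) \<in> ?F\<^sup>*" if "u \<in> set (w i)" for u using walk_in_rtrancl[OF 2] that by auto
  have t3: "(v3, u) \<in> ?F\<^sup>*" if "u \<in> insert v3 (insert ?x (set (pre j)))" for u
    using walk_in_rtrancl[OF 3] that by auto
  have x1: "(v1, ?x) \<in> ?F\<^sup>*" using t1 j(4) by blast
  have x2: "(?x, v2) \<in> ?F\<^sup>*" using t2[OF j(4)] sF by (meson sym_rtrancl symD)
  have x3: "(?x, v3) \<in> ?F\<^sup>*" using t3[of ?x] sF by (meson insertI1 insertI2 sym_rtrancl symD)
  show ?thesis
  proof (rule block_connected_root[OF sym, where r = v1])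
    fix u assume "u \<in> body (Claw i) \<union> ?K"
    then consider "u \<in> insert v1 (set (w i))" | "u = v2" | "u \<in> insert v3 (set (pre j))" using j(3) by auto
    then show "(v1, u) \<in> ?F\<^sup>*"
    proof cases
      case 3
      then have "(v3, u) \<in> ?F\<^sup>*" using t3 by blast
      then show ?thesis by (rule rtrancl_trans[OF rtrancl_trans[OF x1 x3]])
    qed (use t1 rtrancl_trans[OF x1 x2] in simp_all)
  qed
qed

lemma Direct_body: "j \<in> D1 \<union> D2 \<Longrightarrow> body (Direct j) = set (pre j)"
  by (auto simp: body_def leg_def D1_def D2_def)

lemma Direct_connected:
  assumes "j \<in> D1 \<union> D2"
  shows "block_connected E {end_of j, v3} (body (Direct j))"
proof -
  have j: "j < m" using assms by (auto simp: D1_def D2_def)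
  have "set (pre j) \<inter> {v3, end_of j} = {}"
    using pre_terminals[OF j] assms by (auto simp: D1_def D2_def)
  then have "block_connected E {v3, end_of j} (set (pre j))"
    by (intro block_connected_path leg_walk j sym)
  then show ?thesis using Direct_body[OF assms] by (simp add: insert_commute)
qed

lemma Through_connected:
  assumes "i \<in> I0"
  shows "block_connected E {v1, v2} (body (Through i))"
proof -
  have i: "i < m" using in_I(1)[OF assms] by blast
  have "set (w i) \<inter> {v1, v2} = {}" using w_distinct[OF i] by auto
  then show ?thesis using block_connected_path[OF w_walk[OF i] sym] by (simp add: body_def)
qed

lemma label_block:
  assumes "b \<in> labels"
  shows "ends b \<subseteq> {v1, v2, v3}" "block_connected E (ends b) (body b)"
    "ends b = {v1, v2, v3} \<longrightarrow> body b \<noteq> {}"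
proof -
  show "ends b \<subseteq> {v1, v2, v3}"
    using assms by (cases b) (auto simp: labels_iff D1_def D2_def)
  show "block_connected E (ends b) (body b)"
    using assms Through_connected Claw_connected Lower_connected Upper_connected Direct_connected
    by (cases b) (simp_all add: labels_iff)
  show "ends b = {v1, v2, v3} \<longrightarrow> body b \<noteq> {}"
  proof
    assume e: "ends b = {v1, v2, v3}"
    then have c: "card (ends b) = 3" using terminals by simp
    have "card {x, y} \<noteq> 3" for x y :: 'a by (cases "x = y") auto
    then obtain i where "b = Claw i" using c by (cases b) auto
    moreover from this assms have "i \<in> I1" by (simp add: labels_iff)
    ultimately show "body b \<noteq> {}" using Claw_body[of i] by (metis UnI1 empty_iff)
  qed
qed

lemma finite_labels: "finite labels"
  by (auto simp: labels_def I0_def I1_def I2_def D1_def D2_def)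

lemma block_system_blk: "block_system E {v1, v2, v3} (blk ` labels)"
  unfolding block_system_def
proof (intro conjI)
  show "finite (blk ` labels)" using finite_labels by simp
  show "\<forall>(K, W)\<in>blk ` labels. K \<subseteq> {v1, v2, v3} \<and> W \<inter> {v1, v2, v3} = {} \<and>
    block_connected E K W \<and> (K = {v1, v2, v3} \<longrightarrow> W \<noteq> {})"
    using label_block body_terminals by (auto simp: blk_def simp del: insert_subset Int_insert_right)
  show "\<forall>b\<in>blk ` labels. \<forall>b'\<in>blk ` labels. b \<noteq> b' \<longrightarrow> snd b \<inter> snd b' = {}"
    using body_disjoint by (auto simp: blk_def)
qed

section \<open>Counting the blocks by their terminals\<close>

definition kind :: "'a set \<Rightarrow> ('a set \<times> 'a set) set" where
  "kind K = {x \<in> blk ` labels. fst x = K}"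

lemma finite_kind: "finite (kind K)"
  using finite_labels by (simp add: kind_def)

lemma in_kind: "b \<in> labels \<Longrightarrow> ends b = K \<Longrightarrow> blk b \<in> kind K"
  by (auto simp: kind_def blk_def)

text \<open>Collisions do occur: if a path starts with \<open>v1\<close>, \<open>v3\<close> and a
  walk goes straight from \<open>v3\<close> to \<open>v1\<close>, a \<open>Lower\<close> and a
  \<open>Direct\<close> label name the same block.\<close>

lemma blk_eq:
  assumes "b \<in> labels" "b' \<in> labels" "blk b = blk b'" "b \<noteq> b'"
  shows "body b = {}" "body b' = {}"
  using body_disjoint[OF assms(1,2,4)] assms(3) by (auto simp: blk_def)

text \<open>Different labels can name the same block only if their bodies are empty, so one label
  with an empty body is harmless.\<close>

lemma card_le_kind:
  assumes f: "\<And>i. i \<in> A \<Longrightarrow> f i \<in> labels" "\<And>i. i \<in> A \<Longrightarrow> ends (f i) = K"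
    and inj: "\<And>i j. i \<in> A \<Longrightarrow> j \<in> A \<Longrightarrow> f i = f j \<Longrightarrow> i = j"
    and empty: "\<And>i j. i \<in> A \<Longrightarrow> j \<in> A \<Longrightarrow> body (f i) = {} \<Longrightarrow> body (f j) = {} \<Longrightarrow> i = j"
  shows "card A \<le> card (kind K)"
proof (rule card_inj_on_le[where f = "\<lambda>i. blk (f i)"])
  show "inj_on (\<lambda>i. blk (f i)) A"
  proof (rule inj_onI)
    fix i j assume ij: "i \<in> A" "j \<in> A" "blk (f i) = blk (f j)"
    show "i = j"
    proof (cases "f i = f j")
      case False
      from blk_eq[OF f(1)[OF ij(1)] f(1)[OF ij(2)] ij(3) False] show ?thesis using empty ij by blast
    qed (use inj ij in blast)
  qed
  show "(\<lambda>i. blk (f i)) ` A \<subseteq> kind K" using f in_kind by auto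
qed (rule finite_kind)

lemma Claw_nonempty: "i \<in> I1 \<Longrightarrow> body (Claw i) \<noteq> {}"
  by (metis Claw_body UnI1 empty_iff)

lemma card_I1: "card I1 \<le> card (kind {v1, v2, v3})"
  using Claw_nonempty by (intro card_le_kind[of _ Claw]) (auto simp: labels_iff)

lemma card_I0: "card I0 \<le> card (kind {v1, v2})"
proof (intro card_le_kind[of _ Through])
  fix i j assume ij: "i \<in> I0" "j \<in> I0" "body (Through i) = {}" "body (Through j) = {}"
  then have "w i = w j" by (simp add: body_def)
  then show "i = j" using w_disjoint[of i j] in_I(1) ij by blast
qed (auto simp: labels_iff)

lemma hit_terminal:
  assumes "i \<in> I2" "x \<in> {w i ! lo i, w i ! hi i}" "\<Union> (leg ` users x) = {}"
  shows "x = v3"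
proof -
  have "x \<in> stops s" "x \<noteq> v1" "x \<noteq> v2" using hit_stop[of i x] assms by auto
  then show ?thesis by (cases rule: users_leg) (use assms(3) in auto)
qed

lemma terminal_unique:
  assumes "i \<in> I2" "j \<in> I2" "v3 \<in> {w i ! lo i, w i ! hi i}" "v3 \<in> {w j ! lo j, w j ! hi j}"
  shows "i = j"
proof -
  have i: "i < m" "hits i \<noteq> {}" and j: "j < m" "hits j \<noteq> {}" using in_I(3) assms by auto
  obtain a where "a < length (w i)" "w i ! a = v3" using assms(3) lo_hi_length[OF i(2)] by auto
  moreover obtain c where "c < length (w j)" "w j ! c = v3" using assms(4) lo_hi_length[OF j(2)] by auto
  ultimately show ?thesis using w_unique[OF i(1) j(1)] by metis
qed

text \<open>An empty body means that the hit is \<open>v3\<close>, which lies on at most one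
  path.\<close>

lemma card_I2: "card I2 \<le> card (kind {v1, v3})" "card I2 \<le> card (kind {v2, v3})"
proof -
  show "card I2 \<le> card (kind {v1, v3})"
  proof (intro card_le_kind[of _ Lower])
    fix i j assume ij: "i \<in> I2" "j \<in> I2" "body (Lower i) = {}" "body (Lower j) = {}"
    then have "w i ! lo i = v3" "w j ! lo j = v3"
      using hit_terminal[of i "w i ! lo i"] hit_terminal[of j "w j ! lo j"] by (auto simp: body_def)
    then show "i = j" using terminal_unique[OF ij(1,2)] by simp
  qed (auto simp: labels_iff)
  show "card I2 \<le> card (kind {v2, v3})"
  proof (intro card_le_kind[of _ Upper])
    fix i j assume ij: "i \<in> I2" "j \<in> I2" "body (Upper i) = {}" "body (Upper j) = {}"
    then have "w i ! hi i = v3" "w j ! hi j = v3"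
      using hit_terminal[of i "w i ! hi i"] hit_terminal[of j "w j ! hi j"] by (auto simp: body_def)
    then show "i = j" using terminal_unique[OF ij(1,2)] by simp
  qed (auto simp: labels_iff)
qed

lemma legs_single:
  assumes "b \<in> labels" "j \<in> legs b" "j' \<in> legs b"
  shows "j = j'"
proof -
  have u: "j = j'" if "i \<in> I1 \<union> I2" "x \<in> {w i ! lo i, w i ! hi i}" "j \<in> users x" "j' \<in> users x" for i x
    using hit_stop[OF that(1,2)] end_of_inj[of j j'] that(3,4) by (auto simp: users_def)
  show ?thesis using assms u by (cases b) (auto simp: labels_iff)
qed

text \<open>Each label has at most one leg, so walks can be counted through the blocks that contain
  their legs.\<close>

lemma card_legs:
  assumes A: "\<And>j. j \<in> A \<Longrightarrow> \<exists>b\<in>labels. ends b = K \<and> j \<in> legs b"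
    and empty: "\<And>i j. i \<in> A \<Longrightarrow> j \<in> A \<Longrightarrow> leg i = {} \<Longrightarrow> leg j = {} \<Longrightarrow> i = j"
  shows "card A \<le> card (kind K)"
proof -
  obtain f where f: "f j \<in> labels \<and> ends (f j) = K \<and> j \<in> legs (f j)" if "j \<in> A" for j
    using A by metis
  show ?thesis
  proof (rule card_le_kind[of _ f])
    fix i j assume ij: "i \<in> A" "j \<in> A"
    then have "i \<in> legs (f i)" "j \<in> legs (f j)" "f i \<in> labels" using f by auto
    then show "f i = f j \<Longrightarrow> i = j" using legs_single by metis
    show "body (f i) = {} \<Longrightarrow> body (f j) = {} \<Longrightarrow> i = j"
      using empty ij f by (auto simp: body_def)
  qed (use f in auto)
qed

text \<open>The walks whose legs belong to blocks with terminals \<open>{v1, v3}\<close>;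
  \<open>J2\<close> and \<open>J3\<close> are the analogues for \<open>{v2, v3}\<close> and for the
  claws.\<close>

definition J1 :: "nat set" where "J1 = D1 \<union> {j. j < m \<and> (\<exists>i\<in>I2. end_of j = w i ! lo i)}"
definition J2 :: "nat set" where "J2 = D2 \<union> {j. j < m \<and> (\<exists>i\<in>I2. end_of j = w i ! hi i)}"
definition J3 :: "nat set" where "J3 = {j. j < m \<and> (\<exists>i\<in>I1. end_of j = w i ! lo i)}"

lemma leg_empty:
  assumes "leg j = {}"
  shows "end_of j = v1 \<or> end_of j = v2"
  using assms by (auto simp: leg_def)

lemma D1_leg_empty:
  assumes "j \<in> D1" "leg j = {}"
  shows "z j = []"
proof -
  have "j < m" "end_of j = v1" using assms(1) by (auto simp: D1_def)
  then have "s j = length (z j)" by (auto elim: end_of_cases)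
  then show ?thesis using assms(2) by (simp add: leg_def pre_def)
qed

lemma hit_not_terminal:
  assumes "i \<in> I1 \<union> I2" "leg j = {}"
  shows "end_of j \<noteq> w i ! lo i" "end_of j \<noteq> w i ! hi i"
  using hit_stop[OF assms(1), of "w i ! lo i"] hit_stop[OF assms(1), of "w i ! hi i"] leg_empty[OF assms(2)]
  by auto

lemma card_J1: "card J1 \<le> card (kind {v1, v3})"
proof (rule card_legs)
  fix j assume "j \<in> J1"
  then consider "j \<in> D1" | i where "j < m" "i \<in> I2" "end_of j = w i ! lo i" by (auto simp: J1_def)
  then show "\<exists>b\<in>labels. ends b = {v1, v3} \<and> j \<in> legs b"
  proof cases
    case 1
    then show ?thesis by (intro bexI[of _ "Direct j"]) (auto simp: labels_iff D1_def)
  next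
    case 2
    then show ?thesis by (intro bexI[of _ "Lower i"]) (auto simp: labels_iff users_def)
  qed
next
  fix i j assume ij: "i \<in> J1" "j \<in> J1" "leg i = {}" "leg j = {}"
  then have D: "i \<in> D1" "j \<in> D1" using hit_not_terminal by (auto simp: J1_def)
  then have "z i = z j" using D1_leg_empty ij by metis
  then show "i = j" using z_disjoint[of i j] D by (auto simp: D1_def)
qed

lemma card_J2: "card J2 \<le> card (kind {v2, v3})"
proof (rule card_legs)
  fix j assume "j \<in> J2"
  then consider "j \<in> D2" | i where "j < m" "i \<in> I2" "end_of j = w i ! hi i" by (auto simp: J2_def)
  then show "\<exists>b\<in>labels. ends b = {v2, v3} \<and> j \<in> legs b"
  proof cases
    case 1
    then show ?thesis by (intro bexI[of _ "Direct j"]) (auto simp: labels_iff D2_def)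
  next
    case 2
    then show ?thesis by (intro bexI[of _ "Upper i"]) (auto simp: labels_iff users_def)
  qed
next
  fix i j assume ij: "i \<in> J2" "j \<in> J2" "leg i = {}" "leg j = {}"
  then have "i \<in> D2" "j \<in> D2" using hit_not_terminal by (auto simp: J2_def)
  then show "i = j" using end_of_inj[of i j] terminals by (auto simp: D2_def)
qed

lemma card_J3: "card J3 \<le> card (kind {v1, v2, v3})"
proof (rule card_legs)
  fix j assume "j \<in> J3"
  then obtain i where "j < m" "i \<in> I1" "end_of j = w i ! lo i" by (auto simp: J3_def)
  then show "\<exists>b\<in>labels. ends b = {v1, v2, v3} \<and> j \<in> legs b"
    by (intro bexI[of _ "Claw i"]) (auto simp: labels_iff users_def)
next
  fix i j assume "i \<in> J3" "j \<in> J3" "leg i = {}" "leg j = {}"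
  then show "i = j" using hit_not_terminal by (auto simp: J3_def)
qed

text \<open>Stability enters here: a hit strictly between \<open>lo i\<close> and
  \<open>hi i\<close> is between two stops, so a walk that stops on a path stops at its first or
  last hit.\<close>

lemma J_cover: "{..<m} \<subseteq> J1 \<union> J2 \<union> J3"
proof
  fix j assume "j \<in> {..<m}"
  then have j: "j < m" by simp
  from stable[OF j] consider "end_of j = v1" | "end_of j = v2" | "on (end_of j)" "\<not> between s (end_of j)" by blast
  then show "j \<in> J1 \<union> J2 \<union> J3"
  proof cases
    case 3
    then obtain i a where i: "i < m" "a < length (w i)" "w i ! a = end_of j"
      by (auto simp: on_def in_set_conv_nth)
    have a: "a \<in> hits i" using i j by (auto simp: hits_def stops_def)
    then have h: "hits i \<noteq> {}" by blast
    have "a = lo i \<or> a = hi i"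
    proof (rule ccontr)
      assume "\<not> ?thesis"
      then have "lo i < a" "a < hi i" using lo_hi(3)[OF h a] by auto
      then have "between s (end_of j)"
        unfolding between_def using i lo_hi_length[OF h] by blast
      then show False using 3 by simp
    qed
    then show ?thesis
    proof (cases "single i")
      case True
      then have I: "i \<in> I1" using i by (simp add: I1_def)
      then have "a = lo i" using a in_I(2) by blast
      then have "end_of j = w i ! lo i" using i by simp
      then show ?thesis using I j unfolding J3_def by blast
    next
      case False
      then have "i \<in> I2" using i h by (simp add: I2_def)
      moreover have "end_of j = w i ! lo i \<or> end_of j = w i ! hi i"
        using \<open>a = lo i \<or> a = hi i\<close> i by auto
      ultimately show ?thesis using j unfolding J1_def J2_def by blast
    qed
  qed (use j in \<open>auto simp: J1_def J2_def D1_def D2_def\<close>)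
qed

text \<open>The first two bounds count paths: each is kept, becomes a claw, or yields both a
  \<open>Lower\<close> and an \<open>Upper\<close> block. The third counts the walks from
  \<open>v3\<close>.\<close>

lemma kind_counts:
  "m \<le> card (kind {v1, v2}) + card (kind {v1, v3}) + card (kind {v1, v2, v3})"
  "m \<le> card (kind {v1, v2}) + card (kind {v2, v3}) + card (kind {v1, v2, v3})"
  "m \<le> card (kind {v1, v3}) + card (kind {v2, v3}) + card (kind {v1, v2, v3})"
proof -
  have "m = card (I0 \<union> I1 \<union> I2)" using I_disjoint(4) by simp
  also have "\<dots> \<le> card I0 + card I1 + card I2"
    by (meson add_le_mono1 card_Un_le le_trans)
  finally have "m \<le> card I0 + card I1 + card I2" .
  then show "m \<le> card (kind {v1, v2}) + card (kind {v1, v3}) + card (kind {v1, v2, v3})"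
    "m \<le> card (kind {v1, v2}) + card (kind {v2, v3}) + card (kind {v1, v2, v3})"
    using card_I0 card_I1 card_I2 by linarith+
  have "finite (J1 \<union> J2 \<union> J3)" by (auto simp: J1_def J2_def J3_def D1_def D2_def)
  then have "m \<le> card (J1 \<union> J2 \<union> J3)" using card_mono[OF _ J_cover] by simp
  also have "\<dots> \<le> card J1 + card J2 + card J3"
    by (meson add_le_mono1 card_Un_le le_trans)
  finally show "m \<le> card (kind {v1, v3}) + card (kind {v2, v3}) + card (kind {v1, v2, v3})"
    using card_J1 card_J2 card_J3 by linarith
qed

end

lemma block_system_exists:
  assumes fin: "finite V" and EV: "E \<subseteq> V \<times> V" and sym: "sym E" and conn: "k_connected V E m"
    and v: "{v1, v2, v3} \<subseteq> V" "v1 \<noteq> v2" "v1 \<noteq> v3" "v2 \<noteq> v3"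
  shows "\<exists>B. block_system E {v1, v2, v3} B \<and>
    m \<le> card {b \<in> B. fst b = {v1, v2}} + card {b \<in> B. fst b = {v1, v3}} + card {b \<in> B. fst b = {v1, v2, v3}} \<and>
    m \<le> card {b \<in> B. fst b = {v1, v2}} + card {b \<in> B. fst b = {v2, v3}} + card {b \<in> B. fst b = {v1, v2, v3}} \<and>
    m \<le> card {b \<in> B. fst b = {v1, v3}} + card {b \<in> B. fst b = {v2, v3}} + card {b \<in> B. fst b = {v1, v2, v3}}"
proof -
  have vV: "v1 \<in> V" "v2 \<in> V" "v3 \<in> V" using v(1) by auto
  obtain w where w: "\<forall>i<m. walk_in E (v1 # w i @ [v2]) \<and> distinct (v1 # w i @ [v2])"
      "\<forall>i<m. \<forall>j<m. i \<noteq> j \<longrightarrow> set (w i) \<inter> set (w j) = {} \<and> w i \<noteq> w j"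
    using internally_disjoint_paths[OF fin EV sym conn vV(1,2) v(2)] by blast
  obtain z where z: "\<forall>i<m. walk_in E (v3 # z i @ [v1]) \<and> distinct (v3 # z i @ [v1])"
      "\<forall>i<m. \<forall>j<m. i \<noteq> j \<longrightarrow> set (z i) \<inter> set (z j) = {} \<and> z i \<noteq> z j"
    using internally_disjoint_paths[OF fin EV sym conn vV(3,1) v(3)[symmetric]] by blast
  interpret path_systems E v1 v2 v3 m w z
    by unfold_locales (use sym v w z in auto)
  obtain s where s: "valid s" "\<forall>j<m. stop s j = v1 \<or> stop s j = v2 \<or> on (stop s j) \<and> \<not> between s (stop s j)"
    using stable_stops by blast
  interpret stable_paths E v1 v2 v3 m w z s
    by unfold_locales (use s in auto)
  show ?thesis
    using block_system_blk kind_counts unfolding kind_def by blast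
qed

section \<open>Packing trees\<close>

lemma connected_iff_rtrancl:
  assumes "sym (arcs_ends H)" "arcs_ends H \<subseteq> verts H \<times> verts H"
  shows "Digraph_Component.connected H \<longleftrightarrow>
    verts H \<noteq> {} \<and> (\<forall>u\<in>verts H. \<forall>v\<in>verts H. (u, v) \<in> (arcs_ends H)\<^sup>*)"
proof -
  have s: "(arcs_ends H)\<^sup>s = arcs_ends H"
    using assms(1) by (auto simp: symcl_def sym_def)
  have "(u, v) \<in> rtrancl_on (verts H) (arcs_ends H) \<longleftrightarrow> (u, v) \<in> (arcs_ends H)\<^sup>*"
    if uv: "u \<in> verts H" "v \<in> verts H" for u v
  proof
    assume "(u, v) \<in> rtrancl_on (verts H) (arcs_ends H)"
    then show "(u, v) \<in> (arcs_ends H)\<^sup>*"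
      by (induction rule: rtrancl_on_induct) auto
  next
    assume "(u, v) \<in> (arcs_ends H)\<^sup>*"
    then show "(u, v) \<in> rtrancl_on (verts H) (arcs_ends H)"
      by (rule rtrancl_consistent_rtrancl_on) (use uv assms(2) in auto)
  qed
  then show ?thesis unfolding connected_conv s by blast
qed

lemma connected_with_proj:
  assumes "sym (parcs T)" "parcs T \<subseteq> pverts T \<times> pverts T"
  shows "Digraph_Component.connected (with_proj T) \<longleftrightarrow>
    pverts T \<noteq> {} \<and> (\<forall>u\<in>pverts T. \<forall>v\<in>pverts T. (u, v) \<in> (parcs T)\<^sup>*)"
  using connected_iff_rtrancl[of "with_proj T"] assms by simp

section \<open>Spanning trees as minimal connected arc sets\<close>

lemma pcas_rtrancl: "pcas u p v \<Longrightarrow> set p \<subseteq> R \<Longrightarrow> (u, v) \<in> R\<^sup>*"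
proof (induction p arbitrary: u)
  case (Cons e p)
  then have "(u, snd e) \<in> R" by (cases e) auto
  then show ?case using Cons by (auto intro: converse_rtrancl_into_rtrancl)
qed simp

lemma pcas_ConsE:
  assumes "pcas u p v" "p \<noteq> []"
  obtains c q where "p = (u, c) # q" "pcas c q v"
  using assms by (cases p) force+

lemma pcas_end: "pcas u p v \<Longrightarrow> v \<in> set (pawalk_verts u p)"
  by (induction p arbitrary: u) auto

lemma pcas_fst_in: "pcas u p v \<Longrightarrow> (x, y) \<in> set p \<Longrightarrow> x \<in> set (pawalk_verts u p)"
  by (induction p arbitrary: u) auto

lemma path_no_arc_from_end:
  "pcas u p v \<Longrightarrow> distinct (pawalk_verts u p) \<Longrightarrow> (x, y) \<in> set p \<Longrightarrow> x \<noteq> v"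
proof (induction p arbitrary: u)
  case (Cons e p)
  then show ?case using pcas_end[of "snd e" p v] by (cases e) auto
qed simp

text \<open>No arc leaves the last vertex of a path, which excludes \<open>(a, b)\<close>. An arc
  leaving \<open>b\<close> is the first one, and with at least two arcs that one does not end in
  \<open>a\<close>.\<close>

lemma long_path_avoids_edge:
  assumes "pcas b p a" "distinct (pawalk_verts b p)" "length p \<ge> 2"
  shows "(a, b) \<notin> set p" "(b, a) \<notin> set p"
proof -
  show "(a, b) \<notin> set p" using path_no_arc_from_end[OF assms(1,2)] by blast
  have "p \<noteq> []" using assms(3) by auto
  with assms(1) obtain c p' where p': "p = (b, c) # p'" "pcas c p' a" by (rule pcas_ConsE)
  have "p' \<noteq> []" using assms(3) p' by auto
  with p'(2) obtain d q where "p' = (c, d) # q" by (rule pcas_ConsE)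
  then have p: "p = (b, c) # (c, d) # q" using p' by simp
  have ne: "b \<notin> set (pawalk_verts c ((c, d) # q))" using assms(2) p by simp
  have "(b, a) \<notin> set ((c, d) # q)"
    using ne pcas_fst_in[of c "(c, d) # q" a b a] assms(1) p by auto
  moreover have "a \<noteq> c"
    using path_no_arc_from_end[of c "(c, d) # q" a c d] assms(1,2) p by auto
  ultimately show "(b, a) \<notin> set p" using p by auto
qed

text \<open>The rest of the cycle is a path with at least two arcs between the ends of the first
  arc, so it avoids this arc and its opposite.\<close>

lemma cycle_edge_redundant:
  assumes cyc: "pre_digraph.cycle (with_proj T) p" "length p \<ge> 3" and sym: "sym (parcs T)"
  obtains a b where "(a, b) \<in> parcs T" "(b, a) \<in> (parcs T - {(a, b), (b, a)})\<^sup>*"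
proof -
  obtain u where u: "pcas u p u" "set p \<subseteq> parcs T" "distinct (tl (pawalk_verts u p))"
    using cyc unfolding pre_digraph.cycle_def pre_digraph.awalk_def
    by (auto simp: cas_with_proj_eq awalk_verts_with_proj_eq)
  have "p \<noteq> []" using cyc(2) by auto
  with u(1) obtain b q where p: "p = (u, b) # q" by (rule pcas_ConsE)
  have q: "pcas b q u" "distinct (pawalk_verts b q)" "length q \<ge> 2"
    using u cyc(2) p by auto
  have "set q \<subseteq> parcs T - {(u, b), (b, u)}"
    using long_path_avoids_edge[OF q] u(2) p by auto
  then have "(b, u) \<in> (parcs T - {(u, b), (b, u)})\<^sup>*" using pcas_rtrancl q(1) by metis
  then show thesis using that u(2) p by auto
qed

text \<open>Among the symmetric subsets of \<open>F\<close> that connect \<open>U\<close>, one with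
  the fewest arcs is taken; an edge on a cycle could be deleted from it in both directions.\<close>

lemma spanning_tree_exists:
  assumes fin: "finite U" "U \<noteq> {}" and F: "F \<subseteq> U \<times> U" "sym F" "irrefl F"
    and conn: "\<And>u v. u \<in> U \<Longrightarrow> v \<in> U \<Longrightarrow> (u, v) \<in> F\<^sup>*"
  shows "\<exists>T. undirected_tree T \<and> pverts T = U \<and> parcs T \<subseteq> F"
proof -
  define P where "P F' \<longleftrightarrow> F' \<subseteq> F \<and> sym F' \<and> (\<forall>u\<in>U. \<forall>v\<in>U. (u, v) \<in> F'\<^sup>*)" for F'
  have "P F" using F conn by (simp add: P_def)
  then obtain F' where F': "P F'" and min: "P F'' \<Longrightarrow> card F' \<le> card F''" for F''
    using ex_has_least_nat[of P F card] by blast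
  define T where "T = \<lparr>pverts = U, parcs = F'\<rparr>"
  have T: "pverts T = U" "parcs T = F'" by (simp_all add: T_def)
  have sF: "sym F'" "F' \<subseteq> U \<times> U" "irrefl F'" "F' \<subseteq> F"
    using F' F by (auto simp: P_def irrefl_def)
  have finF: "finite F'" using sF(2) fin(1) by (meson finite_SigmaI finite_subset)
  have "pair_graph T"
    using sF finF fin(1) by unfold_locales (auto simp: T symmetric_def irrefl_def)
  moreover have "Digraph_Component.connected (with_proj T)"
    using F' fin sF by (subst connected_with_proj) (auto simp: T P_def)
  moreover have False if cyc: "pre_digraph.cycle (with_proj T) p" "length p \<ge> 3" for p
  proof -
    have sT: "sym (parcs T)" using sF T by simp
    obtain a b where ab: "(a, b) \<in> F'" "(b, a) \<in> (F' - {(a, b), (b, a)})\<^sup>*"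
      using cycle_edge_redundant[OF cyc sT] unfolding T by metis
    let ?D = "F' - {(a, b), (b, a)}"
    have sD: "sym ?D" using sF(1) by (auto simp: sym_def)
    have "(a, b) \<in> ?D\<^sup>*" using ab(2) sD by (meson sym_rtrancl symD)
    then have "F' \<subseteq> ?D\<^sup>*" using ab(2) by auto
    then have "F'\<^sup>* \<subseteq> ?D\<^sup>*" by (metis rtrancl_mono rtrancl_idemp)
    then have "P ?D" using F' sD by (auto simp: P_def)
    moreover have "card ?D < card F'" using ab(1) finF by (intro psubset_card_mono) auto
    ultimately show False using min by fastforce
  qed
  ultimately have "undirected_tree T" by (auto simp: undirected_tree_def)
  then show ?thesis using T sF by blast
qed

section \<open>From blocks to tree packings\<close>

lemma block_systemD:
  assumes "block_system E S B" "b \<in> B"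
  shows "fst b \<subseteq> S" "snd b \<inter> S = {}" "block_connected E (fst b) (snd b)"
    "fst b = S \<Longrightarrow> snd b \<noteq> {}" "b' \<in> B \<Longrightarrow> b \<noteq> b' \<Longrightarrow> snd b \<inter> snd b' = {}"
proof -
  have "\<forall>b\<in>B. fst b \<subseteq> S \<and> snd b \<inter> S = {} \<and> block_connected E (fst b) (snd b) \<and> (fst b = S \<longrightarrow> snd b \<noteq> {})"
    using assms(1) by (simp add: block_system_def case_prod_unfold)
  with assms(2) show "fst b \<subseteq> S" "snd b \<inter> S = {}" "block_connected E (fst b) (snd b)"
    "fst b = S \<Longrightarrow> snd b \<noteq> {}" by blast+
  show "b' \<in> B \<Longrightarrow> b \<noteq> b' \<Longrightarrow> snd b \<inter> snd b' = {}"
    using assms by (simp add: block_system_def)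
qed

lemma block_verts:
  assumes "block_system E S B" "b \<in> B" "E \<subseteq> V \<times> V" "fst b \<noteq> {}"
  shows "snd b \<subseteq> V"
proof
  fix x assume x: "x \<in> snd b"
  obtain a where a: "a \<in> fst b" using assms(4) by blast
  have "(a, x) \<in> (block_arcs E (fst b) (snd b))\<^sup>*" "x \<noteq> a"
    using block_systemD(1-3)[OF assms(1,2)] x a by (auto simp: block_connected_def)
  then have "\<exists>y. (y, x) \<in> block_arcs E (fst b) (snd b)" by (auto elim: rtranclE)
  then show "x \<in> V" using assms(3) by (auto simp: block_arcs_def)
qed

text \<open>The ends of a shared arc lie in both blocks and so are terminals. Hence both blocks lack
  inner vertices, neither has all of \<open>S\<close> as terminals, and both equal
  \<open>({x, y}, {})\<close>.\<close>

lemma block_arcs_disjoint: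
  assumes B: "block_system E S B" "irrefl E" and b: "b \<in> B" "b' \<in> B" "b \<noteq> b'"
    and S: "card S = 3" and K: "\<And>c. c \<in> B \<Longrightarrow> card (fst c) = 2 \<or> fst c = S"
  shows "block_arcs E (fst b) (snd b) \<inter> block_arcs E (fst b') (snd b') = {}"
proof (rule ccontr)
  assume "\<not> ?thesis"
  then obtain x y where xy: "(x, y) \<in> block_arcs E (fst b) (snd b)" "(x, y) \<in> block_arcs E (fst b') (snd b')"
    by auto
  note sub = block_systemD(1,2,4)[OF B(1)]
  have disj: "snd b \<inter> snd b' = {}" using block_systemD(5)[OF B(1)] b by blast
  have T: "x \<in> fst b \<inter> fst b'" "y \<in> fst b \<inter> fst b'"
    using xy disj sub[OF b(1)] sub[OF b(2)] by (auto simp: block_arcs_def)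
  then have W: "snd b = {}" "snd b' = {}" using xy by (auto simp: block_arcs_def)
  have "x \<noteq> y" using xy B(2) by (auto simp: block_arcs_def irrefl_def)
  have two: "fst c = {x, y}" if "c \<in> {b, b'}" for c
  proof -
    have "card (fst c) = 2" using K[of c] sub(3)[of c] W that b by auto
    moreover have "{x, y} \<subseteq> fst c" using T that by auto
    moreover from calculation have "finite (fst c)" by (simp add: card_ge_0_finite)
    ultimately show ?thesis using \<open>x \<noteq> y\<close> by (metis card_2_iff card_subset_eq)
  qed
  then have "fst b = fst b'" by simp
  then have "b = b'" using W by (simp add: prod_eq_iff)
  then show False using b by simp
qed

lemma block_arcs_sub: "block_arcs E K W \<subseteq> (W \<union> K) \<times> (W \<union> K)" "block_arcs E K W \<subseteq> E"
  by (auto simp: block_arcs_def)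

lemma blocks_joined:
  assumes B: "block_system E S B" and Q: "Q \<subseteq> B" "\<Union> (fst ` Q) = S"
    and touch: "\<And>b b'. b \<in> Q \<Longrightarrow> b' \<in> Q \<Longrightarrow> fst b \<inter> fst b' \<noteq> {}"
    and uv: "u \<in> S \<union> \<Union> (snd ` Q)" "v \<in> S \<union> \<Union> (snd ` Q)"
  shows "(u, v) \<in> (\<Union>b\<in>Q. block_arcs E (fst b) (snd b))\<^sup>*"
proof -
  let ?F = "\<Union>b\<in>Q. block_arcs E (fst b) (snd b)"
  have inside: "(x, y) \<in> ?F\<^sup>*" if "b \<in> Q" "x \<in> snd b \<union> fst b" "y \<in> snd b \<union> fst b" for b x y
  proof -
    have "(x, y) \<in> (block_arcs E (fst b) (snd b))\<^sup>*"
      using block_systemD(3)[OF B, of b] Q that by (auto simp: block_connected_def)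
    moreover have "block_arcs E (fst b) (snd b) \<subseteq> ?F" using that by blast
    ultimately show ?thesis using rtrancl_mono by blast
  qed
  obtain b where b: "b \<in> Q" "u \<in> snd b \<union> fst b" using uv(1) Q(2) by blast
  obtain b' where b': "b' \<in> Q" "v \<in> snd b' \<union> fst b'" using uv(2) Q(2) by blast
  obtain x where "x \<in> fst b" "x \<in> fst b'" using touch[OF b(1) b'(1)] by blast
  then have "(u, x) \<in> ?F\<^sup>*" "(x, v) \<in> ?F\<^sup>*" using inside b b' by blast+
  then show ?thesis by (rule rtrancl_trans)
qed

text \<open>The union of the blocks in \<open>P i\<close> is connected, as any two of them share a
  terminal, and \<open>T i\<close> is a spanning tree of it. Disjoint families give trees without
  common arcs that meet only in \<open>S\<close>.\<close>

lemma trees_of_blocks: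
  assumes G: "pair_graph G" and S: "S \<subseteq> pverts G" "card S = 3"
    and B: "block_system (parcs G) S B" and K: "\<And>c. c \<in> B \<Longrightarrow> card (fst c) = 2 \<or> fst c = S"
    and P: "\<And>i. i < l \<Longrightarrow> P i \<subseteq> B \<and> \<Union> (fst ` P i) = S"
    and disj: "\<And>i j. i < l \<Longrightarrow> j < l \<Longrightarrow> i \<noteq> j \<Longrightarrow> P i \<inter> P j = {}"
  shows "\<exists>T :: nat \<Rightarrow> 'a pair_pre_digraph. (\<forall>i<l. tree_connecting G S (T i)) \<and>
     (\<forall>i<l. \<forall>j<l. i \<noteq> j \<longrightarrow>
        parcs (T i) \<inter> parcs (T j) = {} \<and> pverts (T i) \<inter> pverts (T j) = S)"
proof -
  interpret G: pair_graph G by fact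
  let ?E = "parcs G"
  have E: "?E \<subseteq> pverts G \<times> pverts G" "sym ?E" "irrefl ?E"
    by (auto simp: sym_def irrefl_def dest: G.in_arcsD1 G.in_arcsD2 G.arcs_symmetric G.no_loops')
  have finS: "finite S" using S(2) by (simp add: card_ge_0_finite)
  define F where "F i = (\<Union>b\<in>P i. block_arcs ?E (fst b) (snd b))" for i
  define U where "U i = S \<union> \<Union> (snd ` P i)" for i
  have fst_card: "card (fst b) \<ge> 2" "fst b \<subseteq> S" if "b \<in> B" for b
    using K[OF that] S(2) block_systemD(1)[OF B that] by auto
  \<comment> \<open>Two sets of at least two elements cannot be disjoint inside a set of
    three.\<close>
  have touch: "fst b \<inter> fst b' \<noteq> {}" if "b \<in> B" "b' \<in> B" for b b'
  proof
    assume "fst b \<inter> fst b' = {}"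
    moreover have "finite (fst b)" "finite (fst b')" using fst_card finS that by (meson finite_subset)+
    ultimately have "card (fst b \<union> fst b') = card (fst b) + card (fst b')" by (simp add: card_Un_disjoint)
    moreover have "card (fst b \<union> fst b') \<le> card S" using fst_card that finS by (intro card_mono) auto
    ultimately show False using fst_card(1)[OF that(1)] fst_card(1)[OF that(2)] S(2) by linarith
  qed
  have UV: "U i \<subseteq> pverts G" if "i < l" for i
  proof -
    have "snd b \<subseteq> pverts G" if b: "b \<in> P i" for b
    proof (rule block_verts[OF B _ E(1)])
      show "b \<in> B" using P \<open>i < l\<close> b by blast
      then show "fst b \<noteq> {}" using fst_card by fastforce
    qed
    then show ?thesis using S by (auto simp: U_def)
  qed
  have "\<exists>T. undirected_tree T \<and> pverts T = U i \<and> parcs T \<subseteq> F i" if i: "i < l" for i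
  proof (rule spanning_tree_exists)
    show "finite (U i)" using UV[OF i] G.pair_finite_verts by (rule finite_subset)
    show "U i \<noteq> {}" using S(2) by (auto simp: U_def)
    show "F i \<subseteq> U i \<times> U i"
      unfolding F_def
    proof (rule UN_least)
      fix b assume b: "b \<in> P i"
      then have "snd b \<union> fst b \<subseteq> U i" using P[OF i] by (auto simp: U_def)
      then show "block_arcs ?E (fst b) (snd b) \<subseteq> U i \<times> U i" using block_arcs_sub(1) by blast
    qed
    show "sym (F i)"
      unfolding F_def by (rule symI) (use symD[OF sym_block_arcs[OF E(2)]] in blast)
    show "irrefl (F i)" using E(3) by (auto simp: F_def block_arcs_def irrefl_def)
    show "(u, v) \<in> (F i)\<^sup>*" if "u \<in> U i" "v \<in> U i" for u v
      unfolding F_def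
    proof (rule blocks_joined[OF B])
      show "P i \<subseteq> B" "\<Union> (fst ` P i) = S" using P[OF i] by auto
      then show "fst b \<inter> fst b' \<noteq> {}" if "b \<in> P i" "b' \<in> P i" for b b' using touch that by blast
    qed (use that in \<open>simp_all add: U_def\<close>)
  qed
  then obtain T where T: "undirected_tree (T i)" "pverts (T i) = U i" "parcs (T i) \<subseteq> F i" if "i < l" for i
    by metis
  show ?thesis
  proof (intro exI[of _ T] conjI allI impI)
    fix i assume i: "i < l"
    have "F i \<subseteq> ?E" using block_arcs_sub(2) by (auto simp: F_def)
    moreover have "wf_digraph (with_proj (T i))"
      using T(1)[OF i] by (auto simp: undirected_tree_def wf_digraph_wp_iff pair_graph_def pair_digraph_def pair_fin_digraph_def)
    ultimately have "subgraph (with_proj (T i)) (with_proj G)"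
      using T(2,3)[OF i] UV[OF i] G.wf_digraph_axioms by (intro subgraphI) auto
    then show "tree_connecting G S (T i)"
      using T[OF i] by (auto simp: tree_connecting_def U_def)
  next
    fix i j assume ij: "i < l" "j < l" "i \<noteq> j"
    have sep: "b \<in> B \<and> b' \<in> B \<and> b \<noteq> b'" if "b \<in> P i" "b' \<in> P j" for b b'
      using P[OF ij(1)] P[OF ij(2)] disj[OF ij] that by blast
    have "F i \<inter> F j = {}"
      using block_arcs_disjoint[OF B E(3) _ _ _ S(2) K] sep unfolding F_def by blast
    then show "parcs (T i) \<inter> parcs (T j) = {}" using T(3)[OF ij(1)] T(3)[OF ij(2)] by blast
    have "snd b \<inter> snd b' = {}" if "b \<in> P i" "b' \<in> P j" for b b'
      using block_systemD(5)[OF B] sep[OF that] by blast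
    moreover have "snd b \<inter> S = {}" if "b \<in> P i \<union> P j" for b
      using block_systemD(2)[OF B] P[OF ij(1)] P[OF ij(2)] that by blast
    ultimately have "U i \<inter> U j = S" unfolding U_def by blast
    then show "pverts (T i) \<inter> pverts (T j) = S" using T(2) ij by simp
  qed
qed

definition tree_packing :: "'a pair_pre_digraph \<Rightarrow> 'a set \<Rightarrow> nat \<Rightarrow> (nat \<Rightarrow> 'a pair_pre_digraph) \<Rightarrow> bool" where
  "tree_packing G S l T \<longleftrightarrow> (\<forall>i<l. tree_connecting G S (T i)) \<and>
     (\<forall>i<l. \<forall>j<l. i \<noteq> j \<longrightarrow>
        parcs (T i) \<inter> parcs (T j) = {} \<and> pverts (T i) \<inter> pverts (T j) = S)"

lemma set_connectivity_tree_packing: "set_connectivity G S = Max {l. \<exists>T. tree_packing G S l T}"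
  by (simp add: set_connectivity_def tree_packing_def)

text \<open>Each tree joins two different vertices of \<open>S\<close> and so owns an arc of
  \<open>G\<close>. The bound makes the maximum in \<open>set_connectivity\<close> one over a finite
  set.\<close>

lemma tree_packing_bounded:
  assumes G: "pair_graph G" and S: "card S = 3" and T: "tree_packing G S l T"
  shows "l \<le> card (parcs G)"
proof -
  interpret G: pair_graph G by fact
  obtain u v where uv: "u \<in> S" "v \<in> S" "u \<noteq> v"
    using S by (metis card_3_iff insertCI)
  have "\<exists>e. e \<in> parcs (T i) \<and> e \<in> parcs G" if i: "i < l" for i
  proof -
    have t: "undirected_tree (T i)" "S \<subseteq> pverts (T i)" "parcs (T i) \<subseteq> parcs G"
      using T i by (auto simp: tree_packing_def tree_connecting_def subgraph_def)
    interpret t: pair_graph "T i" using t(1) by (simp add: undirected_tree_def)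
    have "sym (parcs (T i))" "parcs (T i) \<subseteq> pverts (T i) \<times> pverts (T i)"
      by (auto simp: sym_def dest: t.in_arcsD1 t.in_arcsD2 t.arcs_symmetric)
    then have "\<forall>u\<in>pverts (T i). \<forall>v\<in>pverts (T i). (u, v) \<in> (parcs (T i))\<^sup>*"
      using connected_with_proj[of "T i"] t(1) by (simp add: undirected_tree_def)
    then have "(u, v) \<in> (parcs (T i))\<^sup>*" using t(2) uv by blast
    then obtain x where "(u, x) \<in> parcs (T i)" using uv(3) by (metis converse_rtranclE)
    then show ?thesis using t(3) by blast
  qed
  then obtain e where e: "e i \<in> parcs (T i)" "e i \<in> parcs G" if "i < l" for i by metis
  have "card {..<l} \<le> card (parcs G)"
  proof (rule card_inj_on_le[where f = e])
    have "parcs (T i) \<inter> parcs (T j) = {}" if "i < l" "j < l" "i \<noteq> j" for i j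
      using T that by (simp add: tree_packing_def)
    then show "inj_on e {..<l}" using e by (intro inj_onI) (metis disjoint_iff lessThan_iff)
  qed (use e G.pair_finite_arcs in auto)
  then show ?thesis by simp
qed

lemma le_set_connectivity:
  assumes G: "pair_graph G" and S: "card S = 3" and T: "tree_packing G S l T"
  shows "l \<le> set_connectivity G S"
  unfolding set_connectivity_tree_packing
proof (rule Max_ge)
  have "{l. \<exists>T. tree_packing G S l T} \<subseteq> {..card (parcs G)}"
    using tree_packing_bounded[OF G S] by auto
  then show "finite {l. \<exists>T. tree_packing G S l T}" by (rule finite_subset) simp
qed (use T in blast)

lemma set_connectivity_le:
  assumes G: "pair_graph G" and S: "card S = 3"
    and bound: "\<And>l T. tree_packing G S l T \<Longrightarrow> l \<le> n"
  shows "set_connectivity G S \<le> n"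
  unfolding set_connectivity_tree_packing
proof (rule Max.boundedI)
  have "{l. \<exists>T. tree_packing G S l T} \<subseteq> {..n}" using bound by auto
  then show "finite {l. \<exists>T. tree_packing G S l T}" by (rule finite_subset) simp
  have "tree_packing G S 0 (\<lambda>_. G)" by (simp add: tree_packing_def)
  then show "{l. \<exists>T. tree_packing G S l T} \<noteq> {}" by blast
qed (use bound in blast)

text \<open>Here \<open>x\<close>, \<open>y\<close>, \<open>z\<close> count the pairs taken from
  \<open>a\<close> and \<open>b\<close>, \<open>a\<close> and \<open>c\<close>, \<open>b\<close> and
  \<open>c\<close>. The hypotheses add up to \<open>a + b + c \<ge> (3 * n + 1) div 2\<close>, and
  half of this, rounded down, is the bound.\<close>

lemma triangle_packing:
  fixes a b c n :: nat
  assumes "n \<le> a + b" "n \<le> a + c" "n \<le> b + c"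
  shows "\<exists>x y z. x + y \<le> a \<and> x + z \<le> b \<and> y + z \<le> c \<and> (3 * n + 1) div 4 \<le> x + y + z"
proof -
  define d where "d = (3 * n + 1) div 4"
  have d: "4 * d \<le> 3 * n + 1" "d \<le> n" by (simp_all add: d_def)
  \<comment> \<open>If one number is at least the sum of the others, these are used up completely;
    otherwise everything can be paired, except one member if the total is odd.\<close>
  consider "b + c \<le> a" | "a + c \<le> b" | "a + b \<le> c" | "a < b + c" "b < a + c" "c < a + b" by linarith
  then show ?thesis
    unfolding d_def[symmetric]
  proof cases
    case 1
    then show "\<exists>x y z. x + y \<le> a \<and> x + z \<le> b \<and> y + z \<le> c \<and> d \<le> x + y + z"
      using d assms by (intro exI[of _ b] exI[of _ c] exI[of _ 0]) auto
  next
    case 2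
    then show "\<exists>x y z. x + y \<le> a \<and> x + z \<le> b \<and> y + z \<le> c \<and> d \<le> x + y + z"
      using d assms by (intro exI[of _ a] exI[of _ 0] exI[of _ c]) auto
  next
    case 3
    then show "\<exists>x y z. x + y \<le> a \<and> x + z \<le> b \<and> y + z \<le> c \<and> d \<le> x + y + z"
      using d assms by (intro exI[of _ 0] exI[of _ a] exI[of _ b]) auto
  next
    case 4
    show "\<exists>x y z. x + y \<le> a \<and> x + z \<le> b \<and> y + z \<le> c \<and> d \<le> x + y + z"
    proof (cases "even (a + b + c)")
      case True
      then obtain t where t: "a + b + c = 2 * t" by blast
      have "c \<le> t" "b \<le> t" "a \<le> t" using t 4 by linarith+
      then obtain p q r where "t = c + p" "t = b + q" "t = a + r" by (metis le_Suc_ex)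
      then show ?thesis
        using t d assms by (intro exI[of _ p] exI[of _ q] exI[of _ r]) linarith
    next
      case False
      then obtain t where t: "a + b + c = 2 * t + 1" by (rule oddE)
      have "c \<le> t + 1" "b \<le> t" "a \<le> t" using t 4 by linarith+
      then obtain p q r where "t + 1 = c + p" "t = b + q" "t = a + r" by (metis le_Suc_ex)
      then show ?thesis
        using t d assms by (intro exI[of _ p] exI[of _ q] exI[of _ r]) linarith
    qed
  qed
qed

text \<open>
  Tree \<open>i\<close> is assembled from the blocks in the slots \<open>(k, t)\<close>, where \<open>k = 1, 2, 3, 4\<close> stands for
  the paths \<open>v1 v2\<close>, \<open>v1 v3\<close>, \<open>v2 v3\<close> and the claws: first \<open>x\<close> trees centred at \<open>v1\<close>, then \<open>y\<close> at \<open>v2\<close>,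
  then \<open>z\<close> at \<open>v3\<close>, then the claws.
\<close>

definition slots :: "nat \<Rightarrow> nat \<Rightarrow> nat \<Rightarrow> nat \<Rightarrow> (nat \<times> nat) set" where
  "slots x y z i =
    (if i < x then {(1, i), (2, i)}
     else if i < x + y then {(1, i), (3, i - x)}
     else if i < x + y + z then {(2, i - y), (3, i - x)}
     else {(4, i - (x + y + z))})"

lemma slots_disjoint: "i \<noteq> j \<Longrightarrow> slots x y z i \<inter> slots x y z j = {}"
  by (auto simp: slots_def split: if_splits)

lemma slots_bound:
  assumes "(k, t) \<in> slots x y z i" "i < x + y + z + c"
  shows "k = 1 \<and> t < x + y \<or> k = 2 \<and> t < x + z \<or> k = 3 \<and> t < y + z \<or> k = 4 \<and> t < c"
  using assms by (auto simp: slots_def split: if_splits)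

lemma block_system_subset:
  assumes "block_system E S B" "B' \<subseteq> B"
  shows "block_system E S B'"
proof -
  have "finite B'" using assms finite_subset unfolding block_system_def by metis
  then show ?thesis using assms unfolding block_system_def by blast
qed

lemma set_connectivity_lower:
  assumes G: "pair_graph G" and conn: "k_connected (pverts G) (parcs G) m"
    and S: "S \<subseteq> pverts G" "card S = 3"
  shows "(3 * m + 1) div 4 \<le> set_connectivity G S"
proof -
  interpret G: pair_graph G by fact
  obtain v1 v2 v3 where v: "S = {v1, v2, v3}" "v1 \<noteq> v2" "v1 \<noteq> v3" "v2 \<noteq> v3"
    using S(2) by (auto simp: card_3_iff)
  have E: "parcs G \<subseteq> pverts G \<times> pverts G" "sym (parcs G)"
    by (auto simp: sym_def dest: G.in_arcsD1 G.in_arcsD2 G.arcs_symmetric)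
  obtain B0 where B0: "block_system (parcs G) S B0"
    "m \<le> card {b \<in> B0. fst b = {v1, v2}} + card {b \<in> B0. fst b = {v1, v3}} + card {b \<in> B0. fst b = S}"
    "m \<le> card {b \<in> B0. fst b = {v1, v2}} + card {b \<in> B0. fst b = {v2, v3}} + card {b \<in> B0. fst b = S}"
    "m \<le> card {b \<in> B0. fst b = {v1, v3}} + card {b \<in> B0. fst b = {v2, v3}} + card {b \<in> B0. fst b = S}"
    using block_system_exists[OF G.pair_finite_verts E conn S(1)[unfolded v(1)] v(2-4), folded v(1)]
    by (elim exE conjE)
  define of_kind where "of_kind K = {b \<in> B0. fst b = K}" for K
  define B where "B = of_kind {v1, v2} \<union> of_kind {v1, v3} \<union> of_kind {v2, v3} \<union> of_kind S"
  have B: "block_system (parcs G) S B"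
    by (rule block_system_subset[OF B0(1)]) (auto simp: B_def of_kind_def)
  have two: "card (fst b) = 2 \<or> fst b = S" if "b \<in> B" for b
    using that v(2-4) unfolding B_def of_kind_def by (elim UnE CollectE conjE) simp_all
  have finK: "finite (of_kind K)" for K
    using B0(1) by (simp add: block_system_def of_kind_def)
  define n where "n K = card (of_kind K)" for K
  have "\<exists>f. bij_betw f {0..<n K} (of_kind K)" for K
    unfolding n_def using ex_bij_betw_nat_finite[OF finK] by blast
  then obtain f where f: "bij_betw (f K) {0..<n K} (of_kind K)" for K by metis
  have "f K i \<in> of_kind K" if "i < n K" for K i
    using bij_betwE[OF f[of K]] that by simp
  then have f_fst: "fst (f K i) = K" "f K i \<in> B0" if "i < n K" for K i
    using that by (simp_all add: of_kind_def)
  have f_inj: "K = K' \<and> i = j" if "f K i = f K' j" "i < n K" "j < n K'" for K K' i j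
  proof -
    have "K = K'" using f_fst(1)[OF that(2)] f_fst(1)[OF that(3)] that(1) by simp
    moreover from this have "i = j"
      using inj_onD[OF bij_betw_imp_inj_on[OF f[of K]], of i j] that by simp
    ultimately show ?thesis ..
  qed
  let ?K1 = "{v1, v2}" and ?K2 = "{v1, v3}" and ?K3 = "{v2, v3}"
  have f_B: "f K i \<in> B" if "i < n K" "K \<in> {?K1, ?K2, ?K3, S}" for K i
    using f_fst[OF that(1)] that(2) unfolding B_def of_kind_def by blast
  \<comment> \<open>The claws occur in all three bounds and are set aside; the difference is
    \<open>0\<close> if there are more than \<open>m\<close> of them.\<close>
  obtain x y z where xyz: "x + y \<le> n ?K1" "x + z \<le> n ?K2" "y + z \<le> n ?K3"
    "(3 * (m - n S) + 1) div 4 \<le> x + y + z"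
    using triangle_packing[of "m - n S" "n ?K1" "n ?K2" "n ?K3"] B0(2-4)
    unfolding n_def of_kind_def by (simp add: le_diff_conv) blast
  define \<kappa> where "\<kappa> k = (if k = 1 then ?K1 else if k = 2 then ?K2 else if k = 3 then ?K3 else S)" for k :: nat
  define P where "P i = (\<lambda>(k, t). f (\<kappa> k) t) ` slots x y z i" for i
  let ?l = "x + y + z + n S"
  have "?K1 \<noteq> ?K2 \<and> ?K1 \<noteq> ?K3 \<and> ?K2 \<noteq> ?K3 \<and> ?K1 \<noteq> S \<and> ?K2 \<noteq> S \<and> ?K3 \<noteq> S"
    using v(2-4) unfolding v(1) by (auto simp: doubleton_eq_iff)
  then have \<kappa>_inj: "k = k'" if "\<kappa> k = \<kappa> k'" "k \<in> {1, 2, 3, 4}" "k' \<in> {1, 2, 3, 4}" for k k'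
    using that unfolding \<kappa>_def by (elim insertE emptyE) simp_all
  have bound: "t < n (\<kappa> k) \<and> k \<in> {1, 2, 3, 4} \<and> \<kappa> k \<in> {?K1, ?K2, ?K3, S}"
    if "(k, t) \<in> slots x y z i" "i < ?l" for k t i
    using slots_bound[OF that] xyz(1-3) unfolding \<kappa>_def by (elim disjE conjE) simp_all
  have "\<exists>T. tree_packing G S ?l T"
    unfolding tree_packing_def
  proof (rule trees_of_blocks[OF G S B two])
    fix i assume i: "i < ?l"
    have "P i \<subseteq> B"
    proof
      fix b assume "b \<in> P i"
      then obtain k t where kt: "(k, t) \<in> slots x y z i" "b = f (\<kappa> k) t" by (auto simp: P_def)
      then show "b \<in> B" using f_B bound[OF kt(1) i] by blast
    qed
    moreover have "\<Union> (fst ` P i) = S"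
    proof -
      have "fst ` P i = (\<lambda>(k, t). \<kappa> k) ` slots x y z i"
        unfolding P_def image_image using bound[OF _ i] f_fst(1) by (intro image_cong) auto
      also have "\<Union> \<dots> = S"
        unfolding v(1) by (auto simp: slots_def \<kappa>_def v(1))
      finally show ?thesis .
    qed
    ultimately show "P i \<subseteq> B \<and> \<Union> (fst ` P i) = S" ..
  next
    fix i j assume ij: "i < ?l" "j < ?l" "i \<noteq> j"
    show "P i \<inter> P j = {}"
    proof (rule ccontr)
      assume "P i \<inter> P j \<noteq> {}"
      then obtain b where "b \<in> P i" "b \<in> P j" by blast
      then obtain k t k' t' where b: "(k, t) \<in> slots x y z i" "b = f (\<kappa> k) t"
        "(k', t') \<in> slots x y z j" "b = f (\<kappa> k') t'" by (auto simp: P_def)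
      note bounds = bound[OF b(1) ij(1)] bound[OF b(3) ij(2)]
      have "f (\<kappa> k) t = f (\<kappa> k') t'" using b(2,4) by simp
      from f_inj[OF this bounds(1)[THEN conjunct1] bounds(2)[THEN conjunct1]]
      have eq: "\<kappa> k = \<kappa> k'" "t = t'" by simp_all
      have "k = k'"
        by (rule \<kappa>_inj[OF eq(1)]) (use bounds in simp_all)
      then have "(k, t) = (k', t')" using eq(2) by simp
      then show False using slots_disjoint[OF ij(3)] b(1,3) by blast
    qed
  qed
  then have "?l \<le> set_connectivity G S" using le_set_connectivity[OF G S(2)] by blast
  \<comment> \<open>A claw is a whole tree, while lowering \<open>m\<close> by one lowers the bound
    by at most one.\<close>
  moreover have "(3 * m + 1) div 4 \<le> ?l" using xyz(4) by linarith
  ultimately show ?thesis by (rule le_trans[rotated])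
qed

section \<open>Connectivity\<close>

lemma induce_connected_iff:
  assumes "pair_graph G"
  shows "Digraph_Component.connected (with_proj G \<restriction> W) \<longleftrightarrow>
    W \<noteq> {} \<and> (\<forall>u\<in>W. \<forall>v\<in>W. (u, v) \<in> (parcs G \<inter> W \<times> W)\<^sup>*)"
proof -
  interpret pair_graph G by fact
  have ends: "arcs_ends (with_proj G \<restriction> W) = parcs G \<inter> W \<times> W"
    by (auto simp: arcs_ends_def arc_to_ends_def)
  have "sym (parcs G \<inter> W \<times> W)" by (auto simp: sym_def dest: arcs_symmetric)
  then show ?thesis using connected_iff_rtrancl[of "with_proj G \<restriction> W"] unfolding ends by simp
qed

definition cutset :: "'a pair_pre_digraph \<Rightarrow> 'a set \<Rightarrow> bool" where
  "cutset G Q \<longleftrightarrow> Q \<subseteq> pverts G \<and>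
     (\<not> Digraph_Component.connected (with_proj G \<restriction> (pverts G - Q)) \<or> card (pverts G - Q) = 1)"

lemma connectivity_cutset: "connectivity G = Min {card Q | Q. cutset G Q}"
  by (simp add: connectivity_def cutset_def)

lemma finite_cutsets: "pair_graph G \<Longrightarrow> finite {card Q | Q. cutset G Q}"
proof -
  assume "pair_graph G"
  then interpret pair_graph G .
  have "{card Q | Q. cutset G Q} \<subseteq> card ` Pow (pverts G)" by (auto simp: cutset_def)
  then show ?thesis using pair_finite_verts by (meson finite_Pow_iff finite_imageI finite_subset)
qed

lemma connectivity_le: "pair_graph G \<Longrightarrow> cutset G Q \<Longrightarrow> connectivity G \<le> card Q"
  unfolding connectivity_cutset by (rule Min_le[OF finite_cutsets]) auto

lemma k_connected_connectivity:
  assumes G: "pair_graph G" and ne: "pverts G \<noteq> {}"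
  shows "k_connected (pverts G) (parcs G) (connectivity G)"
  unfolding k_connected_def
proof (intro conjI allI impI)
  interpret pair_graph G by fact
  obtain x where x: "x \<in> pverts G" using ne by blast
  have "pverts G - (pverts G - {x}) = {x}" using x by blast
  then have "cutset G (pverts G - {x})" by (auto simp: cutset_def)
  then have "connectivity G \<le> card (pverts G - {x})" by (rule connectivity_le[OF G])
  moreover have "card (pverts G - {x}) < card (pverts G)"
    using x pair_finite_verts by (intro psubset_card_mono) auto
  ultimately show "connectivity G < card (pverts G)" by linarith
  fix Q assume "Q \<subseteq> pverts G" "card Q < connectivity G"
  then have "Digraph_Component.connected (with_proj G \<restriction> (pverts G - Q))"
    using connectivity_le[OF G, of Q] unfolding cutset_def by (meson not_le)
  then show "\<forall>a\<in>pverts G - Q. \<forall>b\<in>pverts G - Q.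
      (a, b) \<in> (parcs G \<inter> (pverts G - Q) \<times> (pverts G - Q))\<^sup>*"
    unfolding induce_connected_iff[OF G] by blast
qed

text \<open>Fewer than \<open>m\<close> deletions leave more than one vertex and a connected graph,
  so neither alternative of \<open>cutset\<close> can hold.\<close>

lemma connectivity_eqI:
  assumes G: "pair_graph G" and conn: "k_connected (pverts G) (parcs G) m"
    and Q: "cutset G Q" "card Q = m"
  shows "connectivity G = m"
proof (rule antisym)
  interpret pair_graph G by fact
  show "connectivity G \<le> m" using connectivity_le[OF G Q(1)] Q(2) by simp
  show "m \<le> connectivity G"
    unfolding connectivity_cutset
  proof (rule Min.boundedI[OF finite_cutsets[OF G]])
    show "{card Q | Q. cutset G Q} \<noteq> {}" using Q by blast
    fix c assume "c \<in> {card Q | Q. cutset G Q}"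
    then obtain R where R: "cutset G R" "c = card R" by blast
    have sub: "R \<subseteq> pverts G" using R by (simp add: cutset_def)
    show "m \<le> c"
    proof (rule ccontr)
      assume "\<not> m \<le> c"
      then have less: "card R < m" using R by simp
      have V: "m < card (pverts G)" using conn by (simp add: k_connected_def)
      have "card (pverts G - R) = card (pverts G) - card R"
        using sub pair_finite_verts by (meson card_Diff_subset finite_subset)
      then have big: "card (pverts G - R) > 1" using less V by linarith
      then have "pverts G - R \<noteq> {}" by fastforce
      then have "Digraph_Component.connected (with_proj G \<restriction> (pverts G - R))"
        using conn less sub unfolding induce_connected_iff[OF G] k_connected_def by blast
      then show False using R big by (simp add: cutset_def)
    qed
  qed
qed

lemma set_connectivity_triples:
  assumes "pair_graph G" "card (pverts G) \<ge> 3"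
  shows "finite {set_connectivity G S | S. S \<subseteq> pverts G \<and> card S = 3}"
    "{set_connectivity G S | S. S \<subseteq> pverts G \<and> card S = 3} \<noteq> {}"
proof -
  interpret pair_graph G by fact
  have "{set_connectivity G S | S. S \<subseteq> pverts G \<and> card S = 3} \<subseteq> set_connectivity G ` Pow (pverts G)"
    by blast
  then show "finite {set_connectivity G S | S. S \<subseteq> pverts G \<and> card S = 3}"
    using pair_finite_verts by (meson finite_Pow_iff finite_imageI finite_subset)
  obtain S where "S \<subseteq> pverts G" "card S = 3" using assms(2) by (meson obtain_subset_with_card_n)
  then show "{set_connectivity G S | S. S \<subseteq> pverts G \<and> card S = 3} \<noteq> {}" by blast
qed

lemma connectivity3_lower:
  assumes G: "pair_graph G" and n: "card (pverts G) \<ge> 3"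
  shows "(3 * connectivity G + 1) div 4 \<le> connectivity3 G"
  unfolding connectivity3_def
proof (rule Min.boundedI[OF set_connectivity_triples[OF assms]])
  have ne: "pverts G \<noteq> {}" using n by auto
  fix c assume "c \<in> {set_connectivity G S | S. S \<subseteq> pverts G \<and> card S = 3}"
  then obtain S where "S \<subseteq> pverts G" "card S = 3" "c = set_connectivity G S" by blast
  then show "(3 * connectivity G + 1) div 4 \<le> c"
    using set_connectivity_lower[OF G k_connected_connectivity[OF G ne]] by simp
qed

lemma bound_eq:
  assumes "r \<in> {0, 1, 2, 3}"
  shows "3 * k + nat \<lceil>real r / 2\<rceil> = (3 * (4 * k + r) + 1) div 4"
proof -
  have "\<lceil>real r / 2\<rceil> = (if r = 0 then 0 else if r = 3 then 2 else 1)"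
    using assms by (auto simp: ceiling_eq_iff)
  then show ?thesis using assms by auto
qed

text \<open>
  The extremal graph: the vertices \<open>3, \<dots>, 3t + 2\<close> form a clique, the vertex \<open>x\<close> of which is joined
  to the terminals \<open>i \<in> {0, 1, 2}\<close> with \<open>i \<noteq> x mod 3\<close>; if \<open>d = 1\<close>, there is also the vertex
  \<open>3t + 3\<close> joined to everything. A tree connecting the terminals that avoids this vertex
  contains two vertices of the clique.
\<close>

definition nbrs :: "nat \<Rightarrow> nat \<Rightarrow> nat \<Rightarrow> nat set" where
  "nbrs t d i = {y. 3 \<le> y \<and> y < 3 + 3 * t + d \<and> (y mod 3 \<noteq> i \<or> y = 3 + 3 * t)}"

definition sharp_graph :: "nat \<Rightarrow> nat \<Rightarrow> nat pair_pre_digraph" where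
  "sharp_graph t d = \<lparr>pverts = {..<3 + 3 * t + d},
     parcs = {(x, y). x < 3 + 3 * t + d \<and> y < 3 + 3 * t + d \<and> x \<noteq> y \<and>
       (x < 3 \<longrightarrow> y \<in> nbrs t d x) \<and> (y < 3 \<longrightarrow> x \<in> nbrs t d y)}\<rparr>"

lemma sharp_graph_simps:
  "pverts (sharp_graph t d) = {..<3 + 3 * t + d}"
  "(x, y) \<in> parcs (sharp_graph t d) \<longleftrightarrow> x < 3 + 3 * t + d \<and> y < 3 + 3 * t + d \<and> x \<noteq> y \<and>
       (x < 3 \<longrightarrow> y \<in> nbrs t d x) \<and> (y < 3 \<longrightarrow> x \<in> nbrs t d y)"
  by (simp_all add: sharp_graph_def)

lemma pair_graph_sharp: "pair_graph (sharp_graph t d)"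
proof -
  let ?H = "sharp_graph t d"
  have "parcs ?H \<subseteq> pverts ?H \<times> pverts ?H" by (auto simp: sharp_graph_simps)
  moreover from this have "finite (parcs ?H)"
    by (rule finite_subset) (simp add: sharp_graph_simps)
  moreover have "sym (parcs ?H)" by (auto simp: sym_def sharp_graph_simps)
  ultimately show ?thesis
    by unfold_locales (auto simp: sharp_graph_simps symmetric_def)
qed

lemma card_residues:
  assumes "i < 3"
  shows "card {y. 3 \<le> y \<and> y < 3 + 3 * t \<and> y mod 3 \<noteq> i} = 2 * t"
proof (induction t)
  case (Suc t)
  let ?A = "{y. 3 \<le> y \<and> y < 3 + 3 * t \<and> y mod 3 \<noteq> i}"
  have "{y. 3 \<le> y \<and> y < 3 + 3 * Suc t \<and> y mod 3 \<noteq> i} = ?A \<union> ({3 + 3 * t, 4 + 3 * t, 5 + 3 * t} - {3 + 3 * t + i})"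
    using assms by (auto simp: less_Suc_eq) presburger+
  moreover have "card ({3 + 3 * t, 4 + 3 * t, 5 + 3 * t} - {3 + 3 * t + i}) = 2"
  proof -
    have "3 + 3 * t + i \<in> {3 + 3 * t, 4 + 3 * t, 5 + 3 * t}" using assms by auto
    then show ?thesis by (subst card_Diff_singleton) auto
  qed
  moreover have "finite ?A" by (rule finite_subset[of _ "{..<3 + 3 * t}"]) auto
  moreover have "?A \<inter> ({3 + 3 * t, 4 + 3 * t, 5 + 3 * t} - {3 + 3 * t + i}) = {}" by auto
  ultimately show ?case using Suc by (simp add: card_Un_disjoint)
qed simp

lemma card_nbrs:
  assumes "i < 3" "d \<le> 1"
  shows "card (nbrs t d i) = 2 * t + d"
proof -
  let ?A = "{y. 3 \<le> y \<and> y < 3 + 3 * t \<and> y mod 3 \<noteq> i}"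
  have "finite ?A" by (rule finite_subset[of _ "{..<3 + 3 * t}"]) auto
  moreover have "nbrs t d i = (if d = 0 then ?A else insert (3 + 3 * t) ?A)"
    using assms(2) by (auto simp: nbrs_def)
  ultimately show ?thesis using card_residues[OF assms(1), of t] assms(2) by auto
qed

text \<open>The vertices from \<open>3\<close> on are pairwise adjacent, and fewer than
  \<open>2 * t + d\<close> deletions leave every terminal a neighbour among them.\<close>

lemma k_connected_sharp:
  assumes d: "d \<le> 1"
  shows "k_connected (pverts (sharp_graph t d)) (parcs (sharp_graph t d)) (2 * t + d)"
  unfolding k_connected_def
proof (intro conjI allI impI ballI)
  let ?V = "pverts (sharp_graph t d)" and ?E = "parcs (sharp_graph t d)"
  show "2 * t + d < card ?V" by (simp add: sharp_graph_simps)
  fix Q a b assume Q: "Q \<subseteq> ?V" "card Q < 2 * t + d" and ab: "a \<in> ?V - Q" "b \<in> ?V - Q"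
  let ?F = "?E \<inter> (?V - Q) \<times> (?V - Q)"
  have sF: "sym ?F" by (auto simp: sym_def sharp_graph_simps)
  have hub: "\<exists>y\<in>?V - Q. 3 \<le> y \<and> (x, y) \<in> ?F\<^sup>*" if x: "x \<in> ?V - Q" for x
  proof (cases "x < 3")
    case True
    have "finite Q" using Q(1) by (rule finite_subset) (simp add: sharp_graph_simps)
    then have "\<not> nbrs t d x \<subseteq> Q" using Q(2) card_nbrs[OF True d] card_mono by (metis not_le)
    then obtain y where y: "y \<in> nbrs t d x" "y \<notin> Q" by blast
    then have "(x, y) \<in> ?F" "y \<in> ?V - Q" "3 \<le> y"
      using x True by (auto simp: sharp_graph_simps nbrs_def)
    then show ?thesis by blast
  next
    case False
    then show ?thesis using x by (intro bexI[of _ x]) auto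
  qed
  obtain y where y: "y \<in> ?V - Q" "3 \<le> y" "(a, y) \<in> ?F\<^sup>*" using hub[OF ab(1)] by blast
  obtain z where z: "z \<in> ?V - Q" "3 \<le> z" "(b, z) \<in> ?F\<^sup>*" using hub[OF ab(2)] by blast
  have "(y, z) \<in> ?F\<^sup>*"
    using y z by (cases "y = z") (auto intro!: r_into_rtrancl simp: sharp_graph_simps)
  moreover have "(z, b) \<in> ?F\<^sup>*" using z(3) sF by (meson sym_rtrancl symD)
  ultimately show "(a, b) \<in> ?F\<^sup>*" using y(3) by (meson rtrancl_trans)
qed

lemma connectivity_sharp:
  assumes d: "d \<le> 1"
  shows "connectivity (sharp_graph t d) = 2 * t + d"
proof (rule connectivity_eqI[OF pair_graph_sharp k_connected_sharp[OF d]])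
  let ?H = "sharp_graph t d"
  \<comment> \<open>Deleting these vertices isolates the terminal \<open>0\<close>, while the
    terminal \<open>1\<close> is still present.\<close>
  let ?Q = "nbrs t d 0"
  show "card ?Q = 2 * t + d" using card_nbrs d by simp
  have "\<not> Digraph_Component.connected (with_proj ?H \<restriction> (pverts ?H - ?Q))"
  proof
    let ?W = "pverts ?H - ?Q"
    assume "Digraph_Component.connected (with_proj ?H \<restriction> ?W)"
    moreover have "0 \<in> ?W" "1 \<in> ?W" by (auto simp: sharp_graph_simps nbrs_def)
    ultimately have "(0, 1) \<in> (parcs ?H \<inter> ?W \<times> ?W)\<^sup>*"
      unfolding induce_connected_iff[OF pair_graph_sharp] by blast
    then obtain y where "(0, y) \<in> parcs ?H \<inter> ?W \<times> ?W"
      by (metis converse_rtranclE zero_neq_one)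
    then show False by (auto simp: sharp_graph_simps)
  qed
  moreover have "?Q \<subseteq> pverts ?H" by (auto simp: sharp_graph_simps nbrs_def)
  ultimately show "cutset ?H ?Q" by (simp add: cutset_def)
qed

text \<open>The vertex \<open>3 + 3 * t\<close> can join all terminals alone, hence its weight 2.
  Any other non-terminal \<open>y\<close> misses the terminal \<open>y mod 3\<close>, so a single
  one does not suffice.\<close>

lemma sharp_tree_weight:
  assumes T: "tree_connecting (sharp_graph t d) {0, 1, 2} T"
  shows "2 \<le> (\<Sum>y\<in>pverts T - {0, 1, 2}. if y = 3 + 3 * t then 2 else 1 :: nat)"
proof -
  let ?H = "sharp_graph t d"
  let ?W = "pverts T - {0, 1, 2}"
  have tr: "undirected_tree T" "{0, 1, 2} \<subseteq> pverts T" "parcs T \<subseteq> parcs ?H"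
    using T by (auto simp: tree_connecting_def subgraph_def)
  interpret T: pair_graph T using tr(1) by (simp add: undirected_tree_def)
  have "sym (parcs T)" "parcs T \<subseteq> pverts T \<times> pverts T"
    by (auto simp: sym_def dest: T.in_arcsD1 T.in_arcsD2 T.arcs_symmetric)
  then have conn: "\<forall>u\<in>pverts T. \<forall>v\<in>pverts T. (u, v) \<in> (parcs T)\<^sup>*"
    using connected_with_proj[of T] tr(1) by (simp add: undirected_tree_def)
  have nb: "\<exists>y\<in>?W. y mod 3 \<noteq> i \<or> y = 3 + 3 * t" if i: "i \<in> {0, 1, 2}" for i
  proof -
    obtain j where j: "j \<in> {0, 1, 2}" "j \<noteq> i" using i by (metis insertCI zero_neq_one)
    have "(i, j) \<in> (parcs T)\<^sup>*" using conn tr(2) i j(1) by blast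
    then obtain y where y: "(i, y) \<in> parcs T" using j(2) by (metis converse_rtranclE)
    then have "y \<in> pverts T" "(i, y) \<in> parcs ?H" using T.in_arcsD2 tr(3) by auto
    then have "y \<in> nbrs t d i" using i by (auto simp: sharp_graph_simps)
    then show ?thesis using \<open>y \<in> pverts T\<close> by (intro bexI[of _ y]) (auto simp: nbrs_def)
  qed
  have fin: "finite ?W" using T.pair_finite_verts by simp
  show ?thesis
  proof (cases "3 + 3 * t \<in> ?W")
    case True
    have "(\<Sum>y\<in>{3 + 3 * t}. if y = 3 + 3 * t then 2 else 1 :: nat)
        \<le> (\<Sum>y\<in>?W. if y = 3 + 3 * t then 2 else 1)"
      by (rule sum_mono2[OF fin]) (use True in auto)
    then show ?thesis by simp
  next
    case False
    have "\<exists>y\<in>?W. y mod 3 \<noteq> 0 \<or> y = 3 + 3 * t" by (rule nb) simp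
    then obtain y where y: "y \<in> ?W" by (elim bexE)
    \<comment> \<open>The terminal with the residue of \<open>y\<close> needs a neighbour in the
      tree with another residue; this is the second vertex.\<close>
    have "y mod 3 < 3" by simp
    then have "y mod 3 \<in> {0, 1, 2}" by auto
    from nb[OF this] obtain z where z: "z \<in> ?W" "z mod 3 \<noteq> y mod 3"
    proof (elim bexE disjE)
      fix z assume "z \<in> ?W" "z = 3 + 3 * t"
      then show thesis using False by simp
    qed
    then have "y \<noteq> z" by auto
    then have "2 = card {y, z}" by simp
    also have "\<dots> \<le> card ?W" using y z by (intro card_mono[OF fin]) auto
    also have "\<dots> = (\<Sum>y\<in>?W. 1)" by simp
    also have "\<dots> \<le> (\<Sum>y\<in>?W. if y = 3 + 3 * t then 2 else 1)" by (rule sum_mono) simp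
    finally show ?thesis .
  qed
qed

text \<open>The trees have disjoint sets of non-terminals, each of weight at least 2, and all
  non-terminals together weigh \<open>3 * t + 2 * d\<close>.\<close>

lemma sharp_packing_bound:
  assumes d: "d \<le> 1" and T: "tree_packing (sharp_graph t d) {0, 1, 2} l T"
  shows "2 * l \<le> 3 * t + 2 * d"
proof -
  let ?H = "sharp_graph t d"
  let ?S = "{0, 1, 2} :: nat set"
  let ?wt = "\<lambda>y. if y = 3 + 3 * t then 2 else 1 :: nat"
  have tr: "tree_connecting ?H ?S (T i)" if "i < l" for i
    using T that by (simp add: tree_packing_def)
  have sub: "pverts (T i) \<subseteq> pverts ?H" if "i < l" for i
    using tr[OF that] by (auto simp: tree_connecting_def subgraph_def)
  have fin: "finite (pverts (T i) - ?S)" if "i < l" for i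
    using sub[OF that] by (auto simp: sharp_graph_simps intro: finite_subset)
  have "2 * l = (\<Sum>i<l. 2)" by simp
  also have "\<dots> \<le> (\<Sum>i<l. \<Sum>y\<in>pverts (T i) - ?S. ?wt y)"
    using sharp_tree_weight[OF tr] by (intro sum_mono) auto
  also have "\<dots> = (\<Sum>y\<in>(\<Union>i<l. pverts (T i) - ?S). ?wt y)"
  proof (rule sum.UNION_disjoint[symmetric])
    show "\<forall>i\<in>{..<l}. \<forall>j\<in>{..<l}. i \<noteq> j \<longrightarrow> (pverts (T i) - ?S) \<inter> (pverts (T j) - ?S) = {}"
      using T unfolding tree_packing_def by blast
  qed (use fin in auto)
  also have "\<dots> \<le> (\<Sum>y\<in>{3..<3 + 3 * t + d}. ?wt y)"
  proof (rule sum_mono2)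
    show "(\<Union>i<l. pverts (T i) - ?S) \<subseteq> {3..<3 + 3 * t + d}"
    proof
      fix y assume "y \<in> (\<Union>i<l. pverts (T i) - ?S)"
      then have "y \<in> pverts ?H" "y \<notin> ?S" using sub by auto
      then show "y \<in> {3..<3 + 3 * t + d}" by (auto simp: sharp_graph_simps)
    qed
  qed auto
  also have "\<dots> = 3 * t + 2 * d"
  proof (cases "d = 0")
    case True
    then show ?thesis by simp
  next
    case False
    then have "{3..<3 + 3 * t + d} = insert (3 + 3 * t) {3..<3 + 3 * t}" using d by auto
    then show ?thesis using False d by simp
  qed
  finally show ?thesis .
qed

lemma connectivity3_sharp:
  assumes d: "d \<le> 1"
  shows "connectivity3 (sharp_graph t d) \<le> (3 * t + 2 * d) div 2"
proof -
  let ?H = "sharp_graph t d"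
  let ?S = "{0, 1, 2} :: nat set"
  have "set_connectivity ?H ?S \<le> (3 * t + 2 * d) div 2"
  proof (rule set_connectivity_le[OF pair_graph_sharp])
    fix l T assume "tree_packing ?H ?S l T"
    from sharp_packing_bound[OF d this] show "l \<le> (3 * t + 2 * d) div 2" by linarith
  qed simp
  moreover have "connectivity3 ?H \<le> set_connectivity ?H ?S"
    unfolding connectivity3_def
  proof (rule Min_le[OF set_connectivity_triples(1)[OF pair_graph_sharp]])
    show "3 \<le> card (pverts ?H)" by (simp add: sharp_graph_simps)
    have "?S \<subseteq> pverts ?H" "card ?S = 3" by (auto simp: sharp_graph_simps)
    then show "set_connectivity ?H ?S \<in> {set_connectivity ?H S | S. S \<subseteq> pverts ?H \<and> card S = 3}" by blast
  qed
  ultimately show ?thesis by linarith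
qed

lemma connected_sharp:
  assumes "d \<le> 1" "0 < 2 * t + d"
  shows "Digraph_Component.connected (with_proj (sharp_graph t d))"
proof -
  let ?H = "sharp_graph t d"
  have arcs: "sym (parcs ?H)" "parcs ?H \<subseteq> pverts ?H \<times> pverts ?H"
    by (auto simp: sym_def sharp_graph_simps)
  have "pverts ?H \<noteq> {}" by (simp add: sharp_graph_simps lessThan_empty_iff)
  moreover have "(u, v) \<in> (parcs ?H)\<^sup>*" if "u \<in> pverts ?H" "v \<in> pverts ?H" for u v
  proof -
    have "(u, v) \<in> (parcs ?H \<inter> (pverts ?H - {}) \<times> (pverts ?H - {}))\<^sup>*"
      using k_connected_sharp[OF assms(1), of t] assms(2) that
      unfolding k_connected_def by (metis Diff_empty card.empty empty_subsetI)
    then show ?thesis using rtrancl_mono[of "parcs ?H \<inter> (pverts ?H - {}) \<times> (pverts ?H - {})" "parcs ?H"] by blast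
  qed
  ultimately show ?thesis using connected_with_proj[OF arcs] by blast
qed

theorem theorem3:
  shows "(\<forall>(G :: 'a pair_pre_digraph) (k :: nat) (r :: nat).
            pair_graph G \<and> Digraph_Component.connected (with_proj G) \<and> card (pverts G) \<ge> 3 \<and>
            r \<in> {0, 1, 2, 3} \<and> connectivity G = 4 * k + r \<longrightarrow>
            connectivity3 G \<ge> 3 * k + nat \<lceil>real r / 2\<rceil>) \<and>
         (\<forall>(k :: nat) (r :: nat).
            r \<in> {0, 1, 2, 3} \<and> 4 * k + r \<ge> 1 \<longrightarrow>
            (\<exists>H :: nat pair_pre_digraph.
               pair_graph H \<and> Digraph_Component.connected (with_proj H) \<and> card (pverts H) \<ge> 3 \<and>
               connectivity H = 4 * k + r \<and>
               connectivity3 H = 3 * k + nat \<lceil>real r / 2\<rceil>))"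
proof (intro conjI allI impI; elim conjE)
  fix G :: "'a pair_pre_digraph" and k r :: nat
  assume G: "pair_graph G" "card (pverts G) \<ge> 3" and r: "r \<in> {0, 1, 2, 3}" and c: "connectivity G = 4 * k + r"
  show "connectivity3 G \<ge> 3 * k + nat \<lceil>real r / 2\<rceil>"
    using connectivity3_lower[OF G] unfolding bound_eq[OF r] c .
next
  fix k r :: nat
  assume r: "r \<in> {0, 1, 2, 3}" and pos: "4 * k + r \<ge> 1"
  \<comment> \<open>Forced by the connectivity \<open>2 * t + d\<close> of the extremal graph and
    \<open>d \<le> 1\<close>.\<close>
  define t d where "t = (4 * k + r) div 2" and "d = (4 * k + r) mod 2"
  have td: "2 * t + d = 4 * k + r" "d \<le> 1" by (simp_all add: t_def d_def)
  let ?H = "sharp_graph t d"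
  have c: "connectivity ?H = 4 * k + r" using connectivity_sharp[OF td(2), of t] td(1) by simp
  have n: "card (pverts ?H) \<ge> 3" by (simp add: sharp_graph_simps)
  have "connectivity3 ?H \<le> (3 * t + 2 * d) div 2" by (rule connectivity3_sharp[OF td(2)])
  also have "\<dots> = (3 * (2 * t + d) + 1) div 4"
  proof -
    have "d = 0 \<or> d = 1" using td(2) by auto
    moreover have "(3 * t) div 2 = (3 * (2 * t) + 1) div 4" "(3 * t + 2) div 2 = (3 * (2 * t + 1) + 1) div 4"
      by presburger+
    ultimately show ?thesis by auto
  qed
  also have "\<dots> = (3 * (4 * k + r) + 1) div 4" by (simp only: td(1))
  finally have "connectivity3 ?H = 3 * k + nat \<lceil>real r / 2\<rceil>"
    using connectivity3_lower[OF pair_graph_sharp n] unfolding bound_eq[OF r] c by (rule antisym)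
  moreover have "Digraph_Component.connected (with_proj ?H)"
    by (rule connected_sharp[OF td(2)]) (use td(1) pos in linarith)
  ultimately show "\<exists>H :: nat pair_pre_digraph.
               pair_graph H \<and> Digraph_Component.connected (with_proj H) \<and> card (pverts H) \<ge> 3 \<and>
               connectivity H = 4 * k + r \<and>
               connectivity3 H = 3 * k + nat \<lceil>real r / 2\<rceil>"
    using pair_graph_sharp n c by blast
qed

end
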